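(* Consider the adjacency-list model augmented with $\texttt{JUMP}$ and exactly one of $\texttt{IN-SORTED}$ and $\texttt{ADJ}$ (not both). For any $n$ and $m$ with $n\le m\le n^2$ and any $\delta\in(0,1]$, there exists a directed graph $G=(V,E)$ with $\Theta(n)$ nodes and $\Theta(m)$ edges such that for any algorithm solving the single-pair problem, the expected running time on $G$ with approximation threshold $\delta$, averaged over all sources $s\in V$ and targets $t\in V$, is $\Omega\big(\min\{m,(d/\delta)^{1/2},1/\delta\}\big)$, where $d=m/n$.
   Context: Fix a constant $\alpha\in(0,1)$. For a directed graph $G=(V,E)$, an $\alpha$-discounted random walk from a node $s$: at each step, with probability $\alpha$ it terminates at the current node, and otherwise it moves to a uniformly random out-neighbor of the current node. $\pi(s,t)$ is the probability that such a walk from $s$ terminates at $t$. Adjacency-list model: an algorithm accesses $G$ only through constant-time queries $\texttt{DEG-IN}(u)$, $\texttt{DEG-OUT}(u)$ (in-/out-degree of $u$), $\texttt{IN}(u,i)$, $\texttt{OUT}(u,i)$ ($i$-th in-/out-neighbor of $u$). Additional queries: $\texttt{ADJ}(u,v)$ returns whether $(u,v)\in E$; $\texttt{IN-SORTED}(u,i)$ returns the $i$-th in-neighbor of $u$ when in-neighbors are sorted by out-degree; $\texttt{JUMP}()$ returns a uniformly random node of $V$. Single-pair problem: given $G$ (via queries), $s,t\in V$ and $\delta\in(0,1]$, output $\hat\pi(s,t)$ with $\Pr\{|\hat\pi(s,t)-\pi(s,t)|\ge\varepsilon\max\{\pi(s,t),\delta\}\}\le p_f$, where $\varepsilon,p_f$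 are fixed small constants; an algorithm solves the problem if this holds for every input. *)

theory Defs
  imports "HOL-Probability.Probability"
begin

text \<open>
  Every node is required to have an out-neighbour, since otherwise the step ``move to a uniformly
  random out-neighbour'' is undefined. Self-loops are allowed, parallel edges are not.
\<close>

definition digraph :: "nat set \<Rightarrow> nat rel \<Rightarrow> bool" where
  "digraph V E \<longleftrightarrow> finite V \<and> V \<noteq> {} \<and> E \<subseteq> V \<times> V \<and> (\<forall>u\<in>V. E `` {u} \<noteq> {})"


subsection \<open>Discounted random walks\<close>

text \<open>
  \<open>walk \<alpha> E k u\<close> is the walk from \<open>u\<close> observed for \<open>k\<close> rounds: the node at which it has
  terminated, or \<open>None\<close> if it is still running.
\<close>

primrec walk :: "real \<Rightarrow> nat rel \<Rightarrow> nat \<Rightarrow> nat \<Rightarrow> nat option pmf" where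
  "walk \<alpha> E 0 u = return_pmf None"
| "walk \<alpha> E (Suc k) u =
     bind_pmf (bernoulli_pmf \<alpha>) (\<lambda>stop.
       if stop then return_pmf (Some u)
       else bind_pmf (pmf_of_set (E `` {u})) (walk \<alpha> E k))"

text \<open>The probabilities below increase with \<open>k\<close>, so the supremum is their limit.\<close>

definition ppr :: "real \<Rightarrow> nat rel \<Rightarrow> nat \<Rightarrow> nat \<Rightarrow> real" where
  "ppr \<alpha> E s t = (SUP k. pmf (walk \<alpha> E k s) (Some t))"


subsection \<open>Adjacency-list access\<close>

record adj_lists =
  outs :: "nat \<Rightarrow> nat list"
  ins :: "nat \<Rightarrow> nat list"
  ins_sorted :: "nat \<Rightarrow> nat list"

text \<open>
  The order of the lists is arbitrary, except that \<open>ins_sorted\<close> is non-decreasing in the out-degree,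
  with ties broken arbitrarily.
\<close>

definition adj_lists_of :: "nat set \<Rightarrow> nat rel \<Rightarrow> adj_lists \<Rightarrow> bool" where
  "adj_lists_of V E L \<longleftrightarrow> (\<forall>u\<in>V.
     distinct (outs L u) \<and> set (outs L u) = E `` {u} \<and>
     distinct (ins L u) \<and> set (ins L u) = E\<inverse> `` {u} \<and>
     distinct (ins_sorted L u) \<and> set (ins_sorted L u) = E\<inverse> `` {u} \<and>
     sorted (map (\<lambda>v. card (E `` {v})) (ins_sorted L u)))"

datatype query =
    Deg_In nat | Deg_Out nat | In nat nat | Out nat nat
  | Jump | Adj nat nat | In_Sorted nat nat

datatype answer = Number nat | Node nat | Truth bool | Invalid

datatype extra_query = With_In_Sorted | With_Adj

definition list_answer :: "nat list \<Rightarrow> nat \<Rightarrow> answer" where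
  "list_answer xs i = (if i < length xs then Node (xs ! i) else Invalid)"

text \<open>
  List positions are counted from 0. A query about something that is not a node, a position out of
  range, and a query the model does not offer are all answered by \<open>Invalid\<close>; in the last case the
  answer is the same on all graphs, so the query conveys no information.
\<close>

fun respond :: "extra_query \<Rightarrow> nat set \<Rightarrow> nat rel \<Rightarrow> adj_lists \<Rightarrow> query \<Rightarrow> answer pmf" where
  "respond X V E L (Deg_In u) =
     return_pmf (if u \<in> V then Number (length (ins L u)) else Invalid)"
| "respond X V E L (Deg_Out u) =
     return_pmf (if u \<in> V then Number (length (outs L u)) else Invalid)"
| "respond X V E L (In u i) =
     return_pmf (if u \<in> V then list_answer (ins L u) i else Invalid)"
| "respond X V E L (Out u i) =
     return_pmf (if u \<in> V then list_answer (outs L u) i else Invalid)"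
| "respond X V E L Jump = map_pmf Node (pmf_of_set V)"
| "respond X V E L (Adj u v) =
     return_pmf (if X = With_Adj \<and> u \<in> V \<and> v \<in> V then Truth ((u, v) \<in> E) else Invalid)"
| "respond X V E L (In_Sorted u i) =
     return_pmf (if X = With_In_Sorted \<and> u \<in> V then list_answer (ins_sorted L u) i else Invalid)"


subsection \<open>Randomised algorithms\<close>

text \<open>
  A computation is a possibly infinite tree whose nodes are the unit-time operations: output a value
  and halt, issue a query and continue depending on the answer, or perform an internal operation,
  which may be randomised (a deterministic internal operation is the case of a point distribution).
\<close>

codatatype comp =
    Output real
  | Query query "answer \<Rightarrow> comp"
  | Internal "nat pmf" "nat \<Rightarrow> comp"

text \<open>
  \<open>run R k A\<close> executes at most \<open>k\<close> operations of \<open>A\<close>, with queries answered by \<open>R\<close>. It yields the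
  number of operations executed and the output, if there is one by then.
\<close>

primrec run :: "(query \<Rightarrow> answer pmf) \<Rightarrow> nat \<Rightarrow> comp \<Rightarrow> (nat \<times> real option) pmf" where
  "run R 0 A = return_pmf (0, None)"
| "run R (Suc k) A = map_pmf (\<lambda>(j, y). (Suc j, y))
     (case A of
        Output y \<Rightarrow> return_pmf (0, Some y)
      | Query q f \<Rightarrow> bind_pmf (R q) (\<lambda>a. run R k (f a))
      | Internal p f \<Rightarrow> bind_pmf p (\<lambda>r. run R k (f r)))"

text \<open>
  If \<open>T \<le> \<infinity>\<close> is the running time, the integral is the expectation of \<open>min T k\<close>, so the supremum is
  the expectation of \<open>T\<close>, by monotone convergence.
\<close>

definition expected_time :: "(query \<Rightarrow> answer pmf) \<Rightarrow> comp \<Rightarrow> ennreal" where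
  "expected_time R A = (SUP k. \<integral>\<^sup>+ r. of_nat (fst r) \<partial>measure_pmf (run R k A))"

text \<open>
  The probability of the event \<open>bad\<close> for the output, where never producing an output also counts as
  bad. The probabilities decrease with \<open>k\<close>, so the infimum is their limit.
\<close>

definition failure_prob :: "(query \<Rightarrow> answer pmf) \<Rightarrow> comp \<Rightarrow> (real \<Rightarrow> bool) \<Rightarrow> real" where
  "failure_prob R A bad =
     (INF k. measure_pmf.prob (run R k A)
        {r. case snd r of None \<Rightarrow> True | Some y \<Rightarrow> bad y})"

text \<open>The graph is not an argument of an algorithm: it is only accessible through queries.\<close>

type_synonym algorithm = "nat \<Rightarrow> nat \<Rightarrow> real \<Rightarrow> comp"

definition solves_single_pair :: "extra_query \<Rightarrow> real \<Rightarrow> real \<Rightarrow> real \<Rightarrow> algorithm \<Rightarrow> bool" where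
  "solves_single_pair X \<alpha> \<epsilon> p\<^sub>f A \<longleftrightarrow>
     (\<forall>V E L s t \<delta>. digraph V E \<and> adj_lists_of V E L \<and> s \<in> V \<and> t \<in> V \<and> 0 < \<delta> \<and> \<delta> \<le> 1 \<longrightarrow>
        failure_prob (respond X V E L) (A s t \<delta>)
          (\<lambda>y. \<bar>y - ppr \<alpha> E s t\<bar> \<ge> \<epsilon> * max (ppr \<alpha> E s t) \<delta>) \<le> p\<^sub>f)"

definition average_time ::
    "extra_query \<Rightarrow> nat set \<Rightarrow> nat rel \<Rightarrow> adj_lists \<Rightarrow> real \<Rightarrow> algorithm \<Rightarrow> ennreal" where
  "average_time X V E L \<delta> A =
     (\<Sum>s\<in>V. \<Sum>t\<in>V. expected_time (respond X V E L) (A s t \<delta>)) / of_nat (card V * card V)"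

end

theory Submission
  imports Defs
begin

text \<open>
  Put \<open>q\<close> of the order of the claimed bound. In the hard graph all sources lead to \<open>a\<close> nodes \<open>w\<close> of
  out-degree \<open>b\<close> with \<open>ab \<approx> q\<close>, whose edges \<open>(w, x)\<close> end in a part from which no target can be reached.
  The targets come in groups of size \<open>g\<close>; a group is entered only through its own \<open>g\<close> nodes \<open>z\<close> of
  in-degree \<open>D\<close> with \<open>gD \<approx> q\<close>, and the edges \<open>(y, z)\<close> come from nodes unreachable from the sources. Hence
  \<open>\<pi>(s, t) = 0\<close>, but replacing one pair of edges \<open>(w, x)\<close>, \<open>(y, z)\<close> by \<open>(w, z)\<close>, \<open>(y, x)\<close> raises \<open>\<pi>(s, t)\<close>
  to the order of \<open>1/(abg)\<close>, which is at least \<open>\<delta>/(1 - \<epsilon>)\<close>, so a correct algorithm must notice the swap.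

  The swap keeps all degrees and changes single list entries, so an \<open>IN\<close>, \<open>OUT\<close> or \<open>IN-SORTED\<close> query
  notices only about a fraction \<open>1/q\<close> of the swaps. With \<open>IN-SORTED\<close> we take \<open>b = D\<close>, so that \<open>w\<close> and
  \<open>y\<close> have the same out-degree and sorting does not expose the swap; with \<open>ADJ\<close> we take \<open>a\<close> so large
  that there are \<open>ag \<ge> q/2\<close> candidate pairs \<open>(w, z)\<close>. Thus about \<open>q\<close> queries are needed on average.
\<close>

subsection \<open>Distinguishing oracles by queries\<close>

text \<open>
  The probability that \<open>A\<close>, run with \<open>R\<close> for \<open>k\<close> operations, asks a query on which \<open>R'\<close> differs from \<open>R\<close>.
\<close>

primrec hit :: "(query \<Rightarrow> answer pmf) \<Rightarrow> (query \<Rightarrow> answer pmf) \<Rightarrow> nat \<Rightarrow> comp \<Rightarrow> ennreal" where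
  "hit R R' 0 A = 0"
| "hit R R' (Suc k) A =
     (case A of
        Output y \<Rightarrow> 0
      | Query q f \<Rightarrow> if R' q \<noteq> R q then 1 else \<integral>\<^sup>+ a. hit R R' k (f a) \<partial>measure_pmf (R q)
      | Internal p f \<Rightarrow> \<integral>\<^sup>+ r. hit R R' k (f r) \<partial>measure_pmf p)"

text \<open>The two runs can be coupled to agree until a query with differing answer distributions
  is asked. From such a query on, \<open>hit\<close> is 1 and the bound is trivial.\<close>

lemma emeasure_run_le_hit:
  "emeasure (measure_pmf (run R k A)) S \<le> emeasure (measure_pmf (run R' k A)) S + hit R R' k A"
proof (induction k arbitrary: A S)
  case 0
  show ?case by simp
next
  case (Suc k)
  have step: "(\<integral>\<^sup>+ a. emeasure (measure_pmf (run R k (f a))) U \<partial>measure_pmf p)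
      \<le> (\<integral>\<^sup>+ a. emeasure (measure_pmf (run R' k (f a))) U \<partial>measure_pmf p)
        + (\<integral>\<^sup>+ a. hit R R' k (f a) \<partial>measure_pmf p)"
    for p :: "'b pmf" and f U
    by (subst nn_integral_add[symmetric]) (auto intro!: nn_integral_mono Suc.IH)
  show ?case
  proof (cases A)
    case (Output y)
    then show ?thesis by simp
  next
    case (Query q f)
    show ?thesis
    proof (cases "R' q = R q")
      case True
      then show ?thesis
        using step[of "R q" f] by (simp add: Query emeasure_bind_pmf)
    next
      case False
      have "emeasure (measure_pmf (run R (Suc k) A)) S \<le> 1"
        by (rule measure_pmf.emeasure_le_1)
      also have "\<dots> \<le> emeasure (measure_pmf (run R' (Suc k) A)) S + 1"
        by simp
      finally show ?thesis using False Query by simp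
    qed
  next
    case (Internal p f)
    then show ?thesis
      using step[of p f] by (simp add: emeasure_bind_pmf)
  qed
qed

lemma nn_integral_steps_Suc:
  "(\<integral>\<^sup>+ r. of_nat (fst r) \<partial>measure_pmf (map_pmf (\<lambda>(j, y). (Suc j, y)) M)) =
     1 + (\<integral>\<^sup>+ r. of_nat (fst r) \<partial>measure_pmf M)"
  by (simp add: case_prod_unfold nn_integral_add measure_pmf.emeasure_space_1[simplified])

text \<open>Double counting: in the run with \<open>R\<close>, each executed query exposes at most
  \<open>c\<close> of the alternatives, so every exposure can be charged to an operation.\<close>

lemma sum_hit_le_steps:
  assumes I: "finite I"
    and c: "\<And>q. card {i \<in> I. R' i q \<noteq> R q} \<le> c"
  shows "(\<Sum>i\<in>I. hit R (R' i) k A) \<le> of_nat c * (\<integral>\<^sup>+ r. of_nat (fst r) \<partial>measure_pmf (run R k A))"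
proof (induction k arbitrary: A)
  case 0
  show ?case by simp
next
  case (Suc k)
  have step: "(\<Sum>i\<in>I. \<integral>\<^sup>+ a. hit R (R' i) k (f a) \<partial>measure_pmf p)
      \<le> of_nat c * (\<integral>\<^sup>+ r. of_nat (fst r) \<partial>measure_pmf (bind_pmf p (\<lambda>a. run R k (f a))))"
    for p :: "'b pmf" and f
  proof -
    have "(\<Sum>i\<in>I. \<integral>\<^sup>+ a. hit R (R' i) k (f a) \<partial>measure_pmf p)
        = (\<integral>\<^sup>+ a. (\<Sum>i\<in>I. hit R (R' i) k (f a)) \<partial>measure_pmf p)"
      by (simp add: nn_integral_sum)
    also have "\<dots> \<le> (\<integral>\<^sup>+ a. of_nat c * (\<integral>\<^sup>+ r. of_nat (fst r) \<partial>measure_pmf (run R k (f a))) \<partial>measure_pmf p)"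
      by (intro nn_integral_mono Suc.IH)
    finally show ?thesis
      by (simp add: nn_integral_cmult)
  qed
  show ?case
  proof (cases A)
    case (Output y)
    then show ?thesis by simp
  next
    case (Query q f)
    \<comment> \<open>The continuation is kept also for the instances exposed just now; this
      overcounts, but avoids tracking which instances are still hidden.\<close>
    have "(\<Sum>i\<in>I. hit R (R' i) (Suc k) A)
        \<le> (\<Sum>i\<in>I. (if R' i q \<noteq> R q then 1 else 0) + (\<integral>\<^sup>+ a. hit R (R' i) k (f a) \<partial>measure_pmf (R q)))"
      by (intro sum_mono) (auto simp: Query)
    also have "\<dots> = of_nat (card {i \<in> I. R' i q \<noteq> R q})
        + (\<Sum>i\<in>I. \<integral>\<^sup>+ a. hit R (R' i) k (f a) \<partial>measure_pmf (R q))"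
      using I by (simp add: sum.distrib sum.If_cases Int_def del: sum_of_bool_eq)
    also have "\<dots> \<le> of_nat c + of_nat c *
        (\<integral>\<^sup>+ r. of_nat (fst r) \<partial>measure_pmf (bind_pmf (R q) (\<lambda>a. run R k (f a))))"
      by (intro add_mono step) (simp add: c)
    finally show ?thesis
      by (simp add: Query nn_integral_steps_Suc distrib_left del: nn_integral_map_pmf nn_integral_bind_pmf)
  next
    case (Internal p f)
    have "(\<Sum>i\<in>I. hit R (R' i) (Suc k) A) = (\<Sum>i\<in>I. \<integral>\<^sup>+ a. hit R (R' i) k (f a) \<partial>measure_pmf p)"
      by (simp add: Internal)
    also note step
    finally show ?thesis
      by (simp add: Internal nn_integral_steps_Suc distrib_left add_increasing
          del: nn_integral_map_pmf nn_integral_bind_pmf)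
  qed
qed

section \<open>Truncated failure probabilities and hidden instances\<close>

definition bad_results :: "(real \<Rightarrow> bool) \<Rightarrow> (nat \<times> real option) set" where
  "bad_results bad = {r. case snd r of None \<Rightarrow> True | Some y \<Rightarrow> bad y}"

lemma bad_results_vimage_Suc [simp]:
  "(\<lambda>(j, y). (Suc j, y)) -` bad_results bad = bad_results bad"
  by (auto simp: bad_results_def)

text \<open>A missing output counts as bad, so one more operation can only move a result out of the
  bad event.\<close>

lemma emeasure_run_bad_Suc:
  "emeasure (measure_pmf (run R (Suc k) A)) (bad_results bad)
     \<le> emeasure (measure_pmf (run R k A)) (bad_results bad)"
proof (induction k arbitrary: A)
  case 0
  have "emeasure (measure_pmf (run R 0 A)) (bad_results bad) = 1"
    by (simp add: bad_results_def)
  then show ?case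
    by (metis measure_pmf.emeasure_le_1)
next
  case (Suc k)
  show ?case
    using Suc.IH
    by (simp only: run.simps(2)[of _ "Suc k"] run.simps(2)[of _ k A] emeasure_map_pmf bad_results_vimage_Suc)
      (auto simp: emeasure_bind_pmf split: comp.split intro!: nn_integral_mono simp del: run.simps)
qed

lemma eventually_prob_bad_less:
  assumes "failure_prob R A bad < p"
  shows "\<forall>\<^sub>F k in sequentially. measure_pmf.prob (run R k A) (bad_results bad) < p"
proof -
  define P where "P k = measure_pmf.prob (run R k A) (bad_results bad)" for k
  have dec: "decseq P"
    using emeasure_run_bad_Suc[of R _ A bad]
    by (auto simp: decseq_Suc_iff P_def measure_pmf.emeasure_eq_measure)
  have "(INF k. P k) < p"
    using assms by (simp add: failure_prob_def P_def bad_results_def)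
  then obtain k0 where k0: "P k0 < p"
    by (subst (asm) cINF_less_iff) (auto intro!: bdd_belowI2[where m = 0] simp: P_def)
  show ?thesis
    unfolding P_def[symmetric] using k0 dec
    by (auto simp: eventually_sequentially decseq_def intro!: exI[of _ k0] elim: le_less_trans[rotated])
qed

text \<open>No output is acceptable for both \<open>R\<close> and \<open>R' i\<close>. An unnoticed
  difference would mean failure with probability at least 1/2 on one of the two; hence each instance
  is hit with constant probability, while a single query hits at most \<open>c\<close> of
  them.\<close>

lemma expected_time_ge_of_hidden_instances:
  assumes I: "finite I"
    and c: "\<And>q. card {i \<in> I. R' i q \<noteq> R q} \<le> c"
    and fail: "failure_prob R A bad \<le> p" "\<And>i. i \<in> I \<Longrightarrow> failure_prob (R' i) A (bad' i) \<le> p"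
    and excl: "\<And>i y. i \<in> I \<Longrightarrow> bad y \<or> bad' i y"
    and p: "p < 1 / 2"
  shows "ennreal ((1 - 2 * p) / 2 * card I) \<le> of_nat c * expected_time R A"
proof -
  \<comment> \<open>Strictly above \<open>p\<close>, so that finite truncations get below it, while
    \<open>1 - 2 * p'\<close> still equals \<open>(1 - 2 * p) / 2\<close>.\<close>
  define p' where "p' = p + (1 - 2 * p) / 4"
  have "p < p'"
    using p by (simp add: p'_def)
  then have less: "failure_prob R A bad < p'" "\<And>i. i \<in> I \<Longrightarrow> failure_prob (R' i) A (bad' i) < p'"
    using fail le_less_trans by blast+
  \<comment> \<open>Finiteness of \<open>I\<close> provides one truncation length for all
    instances.\<close>
  have "\<forall>\<^sub>F k in sequentially. measure_pmf.prob (run R k A) (bad_results bad) < p' \<and>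
      (\<forall>i\<in>I. measure_pmf.prob (run (R' i) k A) (bad_results (bad' i)) < p')"
    using I less by (intro eventually_conj eventually_ball_finite ballI eventually_prob_bad_less) auto
  then obtain k where k: "measure_pmf.prob (run R k A) (bad_results bad) < p'"
      "\<And>i. i \<in> I \<Longrightarrow> measure_pmf.prob (run (R' i) k A) (bad_results (bad' i)) < p'"
    by (auto simp: eventually_sequentially)
  have hit: "ennreal ((1 - 2 * p) / 2) \<le> hit R (R' i) k A" if i: "i \<in> I" for i
  proof -
    have U: "bad_results bad \<union> bad_results (bad' i) = UNIV"
      using excl[OF i] by (fastforce simp: bad_results_def split: option.split)
    have "1 = emeasure (measure_pmf (run R k A)) (bad_results bad \<union> bad_results (bad' i))"
      unfolding U using measure_pmf.emeasure_space_1[of "run R k A"] by simp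
    also have "\<dots> \<le> emeasure (measure_pmf (run R k A)) (bad_results bad)
        + emeasure (measure_pmf (run R k A)) (bad_results (bad' i))"
      by (rule emeasure_subadditive) auto
    also have "\<dots> \<le> ennreal p' + (ennreal p' + hit R (R' i) k A)"
    proof (rule add_mono)
      show "emeasure (measure_pmf (run R k A)) (bad_results bad) \<le> ennreal p'"
        using k(1) by (auto simp: measure_pmf.emeasure_eq_measure intro!: ennreal_leI)
      have "emeasure (measure_pmf (run (R' i) k A)) (bad_results (bad' i)) \<le> ennreal p'"
        using k(2)[OF i] by (auto simp: measure_pmf.emeasure_eq_measure intro!: ennreal_leI)
      then show "emeasure (measure_pmf (run R k A)) (bad_results (bad' i))
          \<le> ennreal p' + hit R (R' i) k A"
        by (rule order_trans[OF emeasure_run_le_hit add_right_mono])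
    qed
    finally have *: "1 \<le> ennreal p' + (ennreal p' + hit R (R' i) k A)" .
    have "0 \<le> p'" using k(1) by (meson le_less_trans less_imp_le measure_nonneg)
    show ?thesis
    proof (cases "hit R (R' i) k A")
      case (real h)
      with * \<open>0 \<le> p'\<close> have "1 \<le> p' + (p' + h)"
        by (simp flip: ennreal_plus add: ennreal_1[symmetric] del: ennreal_1)
      then have "(1 - 2 * p) / 2 \<le> h"
        by (simp add: p'_def field_simps)
      then show ?thesis
        using real by (auto intro!: ennreal_leI)
    qed simp
  qed
  have "ennreal ((1 - 2 * p) / 2 * card I) = (\<Sum>i\<in>I. ennreal ((1 - 2 * p) / 2))"
    using p by (subst sum_ennreal) (auto simp: mult.commute)
  also have "\<dots> \<le> (\<Sum>i\<in>I. hit R (R' i) k A)"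
    by (intro sum_mono hit)
  also have "\<dots> \<le> of_nat c * (\<integral>\<^sup>+ r. of_nat (fst r) \<partial>measure_pmf (run R k A))"
    by (rule sum_hit_le_steps[OF I c])
  also have "\<dots> \<le> of_nat c * expected_time R A"
    by (intro mult_left_mono) (auto simp: expected_time_def intro: SUP_upper)
  finally show ?thesis .
qed

text \<open>Covers the regime in which the claimed bound is at most 1.\<close>

lemma expected_time_ge_1: "1 \<le> expected_time R A"
proof -
  have "(1::ennreal) \<le> (\<integral>\<^sup>+ r. of_nat (fst r) \<partial>measure_pmf (run R (Suc 0) A))"
    by (simp only: run.simps nn_integral_steps_Suc) simp
  also have "\<dots> \<le> expected_time R A"
    unfolding expected_time_def by (rule SUP_upper) simp
  finally show ?thesis .
qed

subsection \<open>Discounted random walks\<close>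

lemma walk_le_ppr: "pmf (walk \<alpha> E k s) (Some t) \<le> ppr \<alpha> E s t"
  unfolding ppr_def by (rule cSUP_upper) (auto intro!: bdd_aboveI2[where M = 1] pmf_le_1)

text \<open>Stated with bounds \<open>c\<close> and \<open>r\<close> instead of exact values so that
  it can be chained along a path, each edge costing a factor
  \<open>(1 - \<alpha>) / c\<close>.\<close>

lemma pmf_walk_Suc_ge_edge:
  assumes "(u, v) \<in> E" "finite (E `` {u})" "card (E `` {u}) \<le> c" "0 \<le> \<alpha>" "\<alpha> \<le> 1"
    and r: "0 \<le> r" "r \<le> pmf (walk \<alpha> E k v) (Some t)"
  shows "(1 - \<alpha>) / c * r \<le> pmf (walk \<alpha> E (Suc k) u) (Some t)"
proof -
  have ne: "E `` {u} \<noteq> {}" using assms(1) by auto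
  then have pos: "0 < card (E `` {u})" using assms(2) by (simp add: card_gt_0_iff)
  note r(2)
  also have "pmf (walk \<alpha> E k v) (Some t) \<le> (\<Sum>v'\<in>E `` {u}. pmf (walk \<alpha> E k v') (Some t))"
    using assms by (intro member_le_sum) auto
  finally have "(1 - \<alpha>) * (r / c)
      \<le> (1 - \<alpha>) * ((\<Sum>v'\<in>E `` {u}. pmf (walk \<alpha> E k v') (Some t)) / card (E `` {u}))"
    using assms pos by (intro mult_left_mono frac_le) auto
  also have "\<dots> \<le> pmf (walk \<alpha> E (Suc k) u) (Some t)"
    using assms ne by (simp add: pmf_bind integral_pmf_of_set mult.commute)
  finally show ?thesis by simp
qed

lemma pmf_walk_Suc_self_ge:
  assumes "0 \<le> \<alpha>" "\<alpha> \<le> 1"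
  shows "\<alpha> \<le> pmf (walk \<alpha> E (Suc k) t) (Some t)"
  using assms by (simp add: pmf_bind)

text \<open>A walk never leaves a set closed under out-edges, so it cannot terminate
  outside.\<close>

lemma ppr_eq_0_if_closed:
  assumes "digraph V E" "C \<subseteq> V" "E `` C \<subseteq> C" "s \<in> C" "t \<notin> C"
  shows "ppr \<alpha> E s t = 0"
proof -
  have "set_pmf (walk \<alpha> E k u) \<subseteq> insert None (Some ` C)" if "u \<in> C" for k u
    using that
  proof (induction k arbitrary: u)
    case (Suc k)
    have "finite (E `` {u})" "E `` {u} \<noteq> {}" "E `` {u} \<subseteq> C"
      using assms Suc.prems by (auto simp: digraph_def intro: finite_subset[of _ V])
    then have "set_pmf (pmf_of_set (E `` {u})) = E `` {u}"
      by simp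
    then have "set_pmf (walk \<alpha> E (Suc k) u) \<subseteq> insert (Some u) (\<Union>v\<in>E `` {u}. set_pmf (walk \<alpha> E k v))"
      by (auto split: if_splits simp del: set_pmf_of_set)
    also have "\<dots> \<subseteq> insert None (Some ` C)"
      using Suc.IH Suc.prems \<open>E `` {u} \<subseteq> C\<close> by blast
    finally show ?case .
  qed simp
  then have "pmf (walk \<alpha> E k s) (Some t) = 0" for k
    using assms(4,5) by (auto simp: pmf_eq_0_set_pmf)
  then show ?thesis by (simp add: ppr_def)
qed

subsection \<open>Swapping the ends of two edges\<close>

text \<open>Substitution in place keeps all positions, so a list query at any other entry gets the
  same answer.\<close>

definition replace :: "'a \<Rightarrow> 'a \<Rightarrow> 'a list \<Rightarrow> 'a list" where
  "replace p q = map (\<lambda>v. if v = p then q else v)"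

lemma length_replace [simp]: "length (replace p q xs) = length xs"
  by (simp add: replace_def)

lemma distinct_replace: "distinct xs \<Longrightarrow> q \<notin> set xs \<Longrightarrow> distinct (replace p q xs)"
  by (auto simp: replace_def distinct_map inj_on_def)

lemma set_replace: "p \<in> set xs \<Longrightarrow> set (replace p q xs) = insert q (set xs - {p})"
  by (auto simp: replace_def)

lemma list_answer_replace:
  "list_answer (replace p q xs) i \<noteq> list_answer xs i \<Longrightarrow> xs ! i = p"
  by (auto simp: list_answer_def replace_def split: if_splits)

locale edge_swap =
  fixes X :: extra_query and V :: "nat set" and E :: "nat rel" and L :: adj_lists
    and w x y z :: nat
  assumes G: "digraph V E" and L: "adj_lists_of V E L"
    and edges: "(w, x) \<in> E" "(y, z) \<in> E" and non_edges: "(w, z) \<notin> E" "(y, x) \<notin> E"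
    and out_degrees: "X = With_In_Sorted \<Longrightarrow> card (E `` {w}) = card (E `` {y})"
begin

definition swapped :: "nat rel" where
  "swapped = E - {(w, x), (y, z)} \<union> {(w, z), (y, x)}"

definition replace_in :: "(nat \<Rightarrow> nat list) \<Rightarrow> nat \<Rightarrow> nat list" where
  "replace_in f = f(x := replace w y (f x), z := replace y w (f z))"

text \<open>
  Without \<open>IN-SORTED\<close> queries the sorted lists are invisible, so any sorted order will do; with them,
  equality of the two out-degrees is what allows replacing the in-neighbours in place.
\<close>

definition swapped_lists :: adj_lists where
  "swapped_lists =
     \<lparr>outs = (outs L)(w := replace x z (outs L w), y := replace z x (outs L y)),
      ins = replace_in (ins L),
      ins_sorted =
        (if X = With_In_Sorted then replace_in (ins_sorted L)
         else (\<lambda>u. sort_key (\<lambda>v. card (swapped `` {v})) (replace_in (ins L) u)))\<rparr>"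

lemma distinct_ends: "w \<noteq> y" "y \<noteq> w" "x \<noteq> z" "z \<noteq> x"
  using edges non_edges by auto

lemma nodes: "w \<in> V" "x \<in> V" "y \<in> V" "z \<in> V"
  using edges G by (auto simp: digraph_def)

lemma finite_out [simp]: "finite (E `` {u})"
  using G by (auto simp: digraph_def intro: finite_subset[of _ V])

lemma swapped_out:
  "swapped `` {u} = (if u = w then insert z (E `` {w} - {x})
     else if u = y then insert x (E `` {y} - {z}) else E `` {u})"
  using edges non_edges distinct_ends by (auto simp: swapped_def)

lemma swapped_in:
  "swapped\<inverse> `` {u} = (if u = x then insert y (E\<inverse> `` {x} - {w})
     else if u = z then insert w (E\<inverse> `` {z} - {y}) else E\<inverse> `` {u})"
  using edges non_edges distinct_ends by (auto simp: swapped_def)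

text \<open>One out-neighbour is exchanged for a node that was not one before; this is where
  \<open>non_edges\<close> enters.\<close>

lemma card_swapped_out [simp]: "card (swapped `` {u}) = card (E `` {u})"
proof -
  have "card (insert c (A - {d})) = card A" if "finite A" "d \<in> A" "c \<notin> A" for A and c d :: nat
    using that by (metis card_Suc_Diff1 card_insert_disjoint finite_Diff DiffD1)
  then show ?thesis
    using edges non_edges by (auto simp: swapped_out)
qed

lemma digraph_swapped: "digraph V swapped"
  unfolding digraph_def
proof (intro conjI ballI)
  show "finite V" "V \<noteq> {}" using G by (auto simp: digraph_def)
  show "swapped \<subseteq> V \<times> V" using G nodes by (auto simp: digraph_def swapped_def)
  fix u assume "u \<in> V"
  then have "E `` {u} \<noteq> {}" using G by (auto simp: digraph_def)
  then have "card (swapped `` {u}) \<noteq> 0" by simp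
  then show "swapped `` {u} \<noteq> {}" by force
qed

lemma replace_in_correct:
  assumes "u \<in> V" "\<And>u. u \<in> V \<Longrightarrow> distinct (f u) \<and> set (f u) = E\<inverse> `` {u}"
  shows "distinct (replace_in f u)" "set (replace_in f u) = swapped\<inverse> `` {u}"
proof -
  have *: "distinct (f u)" "set (f u) = E\<inverse> `` {u}" if "u \<in> V" for u
    using assms(2) that by auto
  show "distinct (replace_in f u)"
    using edges non_edges distinct_ends nodes *[of u] *[of x] *[of z] assms(1)
    by (auto simp: replace_in_def intro!: distinct_replace)
  show "set (replace_in f u) = swapped\<inverse> `` {u}"
    using edges non_edges distinct_ends nodes *[of u] *[of x] *[of z] assms(1)
    unfolding swapped_in by (auto simp: replace_in_def set_replace)
qed

lemma adj_lists_of_swapped: "adj_lists_of V swapped swapped_lists"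
  unfolding adj_lists_of_def
proof (intro ballI conjI)
  fix u assume u: "u \<in> V"
  have L': "distinct (outs L u)" "set (outs L u) = E `` {u}"
     "distinct (ins L u) \<and> set (ins L u) = E\<inverse> `` {u}"
     "distinct (ins_sorted L u) \<and> set (ins_sorted L u) = E\<inverse> `` {u}"
     "sorted (map (\<lambda>v. card (E `` {v})) (ins_sorted L u))" if "u \<in> V" for u
    using L that by (auto simp: adj_lists_of_def)
  show "distinct (outs swapped_lists u)"
    using non_edges L'(1,2)[OF u] by (auto simp: swapped_lists_def intro!: distinct_replace)
  show "set (outs swapped_lists u) = swapped `` {u}"
    using edges distinct_ends L'(2)[OF u]
    by (cases "u = w"; cases "u = y") (simp_all add: swapped_out swapped_lists_def set_replace)
  note ins = replace_in_correct[OF u L'(3)] and sorted = replace_in_correct[OF u L'(4)]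
  show "distinct (ins swapped_lists u)" "set (ins swapped_lists u) = swapped\<inverse> `` {u}"
    using ins by (auto simp: swapped_lists_def)
  show "distinct (ins_sorted swapped_lists u)" "set (ins_sorted swapped_lists u) = swapped\<inverse> `` {u}"
    using ins sorted by (auto simp: swapped_lists_def)
  show "sorted (map (\<lambda>v. card (swapped `` {v})) (ins_sorted swapped_lists u))"
  proof (cases "X = With_In_Sorted")
    case True
    have "map (\<lambda>v. card (E `` {v})) (replace_in (ins_sorted L) u) =
        map (\<lambda>v. card (E `` {v})) (ins_sorted L u)"
      using out_degrees[OF True] by (auto simp: replace_in_def replace_def)
    then show ?thesis
      using L'(5)[OF u] True unfolding swapped_lists_def by simp
  next
    case False
    then show ?thesis
      unfolding swapped_lists_def by simp
  qed
qed

text \<open>Degrees and the node set are unchanged, and a list changes only at the entry of a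
  removed edge. Only an adjacency query can also see an inserted edge.\<close>

lemma respond_swapped_neqD:
  assumes "respond X V swapped swapped_lists q \<noteq> respond X V E L q"
  shows "case q of
      In u i \<Rightarrow> (ins L u ! i, u) \<in> {(w, x), (y, z)}
    | Out u i \<Rightarrow> (u, outs L u ! i) \<in> {(w, x), (y, z)}
    | In_Sorted u i \<Rightarrow> (ins_sorted L u ! i, u) \<in> {(w, x), (y, z)}
    | Adj u v \<Rightarrow> X = With_Adj \<and> (u, v) \<in> {(w, x), (y, z), (w, z), (y, x)}
    | _ \<Rightarrow> False"
  using assms
  by (cases q) (auto simp: swapped_lists_def replace_in_def swapped_def
      dest: list_answer_replace split: if_splits)

end

section \<open>Counting the swaps that a query notices\<close>

lemma card_pairs_le:
  assumes fin: "finite E\<^sub>1" "finite E\<^sub>2"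
    and sub: "S \<subseteq> {(e\<^sub>1, e\<^sub>2) \<in> E\<^sub>1 \<times> E\<^sub>2. e\<^sub>1 = e \<or> e\<^sub>2 = e'}"
  shows "card S \<le> card E\<^sub>1 + card E\<^sub>2"
proof -
  have "card S \<le> card ({e} \<times> E\<^sub>2 \<union> E\<^sub>1 \<times> {e'})"
    using fin sub by (intro card_mono) auto
  also have "\<dots> \<le> card ({e} \<times> E\<^sub>2) + card (E\<^sub>1 \<times> {e'})"
    by (rule card_Un_le)
  finally show ?thesis by (simp add: card_cartesian_product)
qed

text \<open>The hidden instances are the swaps of an edge of \<open>E\<^sub>1\<close> with one of
  \<open>E\<^sub>2\<close>. A list query concerns a single edge, which leaves only the other one
  free. An adjacency query may also test an inserted edge; this fixes one end of each removed edge,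
  with at most \<open>b * d\<close> choices for either kind of inserted edge.\<close>

lemma expected_time_ge_of_swaps:
  fixes b d :: nat
  assumes G: "digraph V E" and L: "adj_lists_of V E L"
    and sub: "E\<^sub>1 \<subseteq> E" "E\<^sub>2 \<subseteq> E"
    and swap: "\<And>w x y z. (w, x) \<in> E\<^sub>1 \<Longrightarrow> (y, z) \<in> E\<^sub>2 \<Longrightarrow>
      (w, z) \<notin> E \<and> (y, x) \<notin> E \<and> (X = With_In_Sorted \<longrightarrow> card (E `` {w}) = card (E `` {y})) \<and>
      \<delta> / (1 - \<epsilon>) \<le> ppr \<alpha> (E - {(w, x), (y, z)} \<union> {(w, z), (y, x)}) s t"
    and b: "\<And>u. card {e \<in> E\<^sub>1. fst e = u} \<le> b" "\<And>u. card {e \<in> E\<^sub>1. snd e = u} \<le> b"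
    and d: "\<And>u. card {e \<in> E\<^sub>2. fst e = u} \<le> d" "\<And>u. card {e \<in> E\<^sub>2. snd e = u} \<le> d"
    and A: "solves_single_pair X \<alpha> \<epsilon> p A" and st: "s \<in> V" "t \<in> V" and zero: "ppr \<alpha> E s t = 0"
    and \<delta>: "0 < \<delta>" "\<delta> \<le> 1" and \<epsilon>: "0 < \<epsilon>" "\<epsilon> < 1" and p: "p < 1 / 2"
  shows "ennreal ((1 - 2 * p) / 2 * (card E\<^sub>1 * card E\<^sub>2)) \<le>
    of_nat (card E\<^sub>1 + card E\<^sub>2 + (if X = With_Adj then 2 * (b * d) else 0)) *
    expected_time (respond X V E L) (A s t \<delta>)"
proof -
  have "finite E" using G by (auto simp: digraph_def intro: finite_subset[of _ "V \<times> V"])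
  then have fin: "finite E\<^sub>1" "finite E\<^sub>2" using sub by (auto intro: finite_subset)
  define E' where "E' = (\<lambda>((w, x), (y, z)). edge_swap.swapped E w x y z)"
  define L' where "L' = (\<lambda>((w, x), (y, z)). edge_swap.swapped_lists X E L w x y z)"
  define R' where "R' i = respond X V (E' i) (L' i)" for i
  have swp: "edge_swap X V E L w x y z" if "(w, x) \<in> E\<^sub>1" "(y, z) \<in> E\<^sub>2" for w x y z
    using swap[OF that] sub that G L by unfold_locales auto
  have ppr': "\<delta> / (1 - \<epsilon>) \<le> ppr \<alpha> (E' i) s t" if "i \<in> E\<^sub>1 \<times> E\<^sub>2" for i
    using that swap swp by (force simp: E'_def edge_swap.swapped_def)
  define P where "P q w x y z \<longleftrightarrow> (case q of
        In u i \<Rightarrow> (ins L u ! i, u) \<in> {(w, x), (y, z)}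
      | Out u i \<Rightarrow> (u, outs L u ! i) \<in> {(w, x), (y, z)}
      | In_Sorted u i \<Rightarrow> (ins_sorted L u ! i, u) \<in> {(w, x), (y, z)}
      | Adj u v \<Rightarrow> X = With_Adj \<and> (u, v) \<in> {(w, x), (y, z), (w, z), (y, x)}
      | _ \<Rightarrow> False)" for q w x y z
  have P: "P q w x y z" if "(w, x) \<in> E\<^sub>1" "(y, z) \<in> E\<^sub>2" "R' ((w, x), (y, z)) q \<noteq> respond X V E L q"
    for q w x y z
    using edge_swap.respond_swapped_neqD[OF swp[OF that(1,2)], of q] that(3)
    by (simp add: R'_def E'_def L'_def P_def)
  \<comment> \<open>Contains all swaps noticed by the query, described by the edges concerned
    instead of by the answers.\<close>
  define S where "S q = {((w, x), (y, z)) |w x y z. (w, x) \<in> E\<^sub>1 \<and> (y, z) \<in> E\<^sub>2 \<and> P q w x y z}" for q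
  have finS: "finite (S q)" for q
    by (rule finite_subset[of _ "E\<^sub>1 \<times> E\<^sub>2"]) (use fin in \<open>auto simp: S_def\<close>)
  have "card (S q) \<le> card E\<^sub>1 + card E\<^sub>2 + (if X = With_Adj then 2 * (b * d) else 0)" for q
  proof (cases q)
    case (In u i)
    have "card (S q) \<le> card E\<^sub>1 + card E\<^sub>2"
      by (rule card_pairs_le[OF fin, of _ "(ins L u ! i, u)" "(ins L u ! i, u)"]) (auto simp: S_def P_def In)
    then show ?thesis by simp
  next
    case (Out u i)
    have "card (S q) \<le> card E\<^sub>1 + card E\<^sub>2"
      by (rule card_pairs_le[OF fin, of _ "(u, outs L u ! i)" "(u, outs L u ! i)"]) (auto simp: S_def P_def Out)
    then show ?thesis by simp
  next
    case (In_Sorted u i)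
    have "card (S q) \<le> card E\<^sub>1 + card E\<^sub>2"
      by (rule card_pairs_le[OF fin, of _ "(ins_sorted L u ! i, u)" "(ins_sorted L u ! i, u)"])
        (auto simp: S_def P_def In_Sorted)
    then show ?thesis by simp
  next
    case (Adj u v)
    show ?thesis
    proof (cases "X = With_Adj")
      case True
      \<comment> \<open>Three ways to notice a swap: the tested pair is a removed edge, the inserted
        edge \<open>(w, z)\<close>, or the inserted edge \<open>(y, x)\<close>.\<close>
      define S\<^sub>1 where "S\<^sub>1 = {(e\<^sub>1, e\<^sub>2) \<in> E\<^sub>1 \<times> E\<^sub>2. e\<^sub>1 = (u, v) \<or> e\<^sub>2 = (u, v)}"
      define S\<^sub>2 where "S\<^sub>2 = {e \<in> E\<^sub>1. fst e = u} \<times> {e \<in> E\<^sub>2. snd e = v}"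
      define S\<^sub>3 where "S\<^sub>3 = {e \<in> E\<^sub>1. snd e = v} \<times> {e \<in> E\<^sub>2. fst e = u}"
      have "card (S q) \<le> card (S\<^sub>1 \<union> (S\<^sub>2 \<union> S\<^sub>3))"
      proof (rule card_mono)
        show "finite (S\<^sub>1 \<union> (S\<^sub>2 \<union> S\<^sub>3))"
          by (rule finite_subset[of _ "E\<^sub>1 \<times> E\<^sub>2"]) (use fin in \<open>auto simp: S\<^sub>1_def S\<^sub>2_def S\<^sub>3_def\<close>)
        show "S q \<subseteq> S\<^sub>1 \<union> (S\<^sub>2 \<union> S\<^sub>3)"
          by (auto simp: S_def P_def Adj S\<^sub>1_def S\<^sub>2_def S\<^sub>3_def)
      qed
      also have "\<dots> \<le> card S\<^sub>1 + (card S\<^sub>2 + card S\<^sub>3)"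
        by (meson add_le_mono card_Un_le le_refl order_trans)
      also have "card S\<^sub>1 \<le> card E\<^sub>1 + card E\<^sub>2"
        unfolding S\<^sub>1_def by (rule card_pairs_le[OF fin]) blast
      also have "card S\<^sub>2 \<le> b * d"
        unfolding S\<^sub>2_def card_cartesian_product by (intro mult_mono b d) auto
      also have "card S\<^sub>3 \<le> b * d"
        unfolding S\<^sub>3_def card_cartesian_product by (intro mult_mono b d) auto
      finally show ?thesis using True by simp
    next
      case False
      then have "S q = {}" by (auto simp: S_def P_def Adj)
      then show ?thesis by simp
    qed
  qed (auto simp: S_def P_def)
  moreover have "card {i \<in> E\<^sub>1 \<times> E\<^sub>2. R' i q \<noteq> respond X V E L q} \<le> card (S q)" for q
    by (intro card_mono finS) (auto simp: S_def intro!: P)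
  ultimately have diff: "card {i \<in> E\<^sub>1 \<times> E\<^sub>2. R' i q \<noteq> respond X V E L q}
      \<le> card E\<^sub>1 + card E\<^sub>2 + (if X = With_Adj then 2 * (b * d) else 0)" for q
    using order_trans by blast
  have "ennreal ((1 - 2 * p) / 2 * card (E\<^sub>1 \<times> E\<^sub>2)) \<le>
      of_nat (card E\<^sub>1 + card E\<^sub>2 + (if X = With_Adj then 2 * (b * d) else 0)) *
      expected_time (respond X V E L) (A s t \<delta>)"
  proof (rule expected_time_ge_of_hidden_instances[OF _ diff _ _ _ p])
    show "finite (E\<^sub>1 \<times> E\<^sub>2)" using fin by simp
    show "failure_prob (respond X V E L) (A s t \<delta>)
        (\<lambda>r. \<bar>r - ppr \<alpha> E s t\<bar> \<ge> \<epsilon> * max (ppr \<alpha> E s t) \<delta>) \<le> p"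
      using A G L st \<delta> unfolding solves_single_pair_def by blast
    fix i assume i: "i \<in> E\<^sub>1 \<times> E\<^sub>2"
    obtain w x y z where i_eq: "i = ((w, x), (y, z))" by (metis prod.collapse)
    have s: "edge_swap X V E L w x y z" using i by (intro swp) (auto simp: i_eq)
    show "failure_prob (R' i) (A s t \<delta>)
        (\<lambda>r. \<bar>r - ppr \<alpha> (E' i) s t\<bar> \<ge> \<epsilon> * max (ppr \<alpha> (E' i) s t) \<delta>) \<le> p"
      using A st \<delta> edge_swap.digraph_swapped[OF s] edge_swap.adj_lists_of_swapped[OF s]
      unfolding solves_single_pair_def R'_def by (simp add: i_eq E'_def L'_def)
    fix r
    \<comment> \<open>An output accepted for the value 0 is below
      \<open>\<epsilon> * \<delta>\<close>, hence below \<delta>; one accepted after the swap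
      exceeds \<open>(1 - \<epsilon>)\<close> times the new value, hence \<delta>. This is why the
      threshold is \<open>\<delta> / (1 - \<epsilon>)\<close>.\<close>
    have \<pi>: "\<delta> \<le> ppr \<alpha> (E' i) s t * (1 - \<epsilon>)"
      using ppr'[OF i] \<epsilon> by (simp add: divide_le_eq)
    moreover have "\<delta> \<le> \<delta> / (1 - \<epsilon>)"
      using \<epsilon> \<delta> by (simp add: le_divide_eq)
    ultimately have max: "max (ppr \<alpha> (E' i) s t) \<delta> = ppr \<alpha> (E' i) s t"
      using ppr'[OF i] by simp
    have "\<epsilon> * ppr \<alpha> (E' i) s t \<le> \<bar>r - ppr \<alpha> (E' i) s t\<bar>" if "\<not> \<epsilon> * \<delta> \<le> \<bar>r\<bar>"
    proof -
      have "\<epsilon> * \<delta> \<le> \<delta>" using \<epsilon> \<delta> by simp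
      moreover have "\<delta> \<le> ppr \<alpha> (E' i) s t - \<epsilon> * ppr \<alpha> (E' i) s t"
        using \<pi> by (simp add: algebra_simps)
      ultimately show ?thesis using that by linarith
    qed
    then show "\<bar>r - ppr \<alpha> E s t\<bar> \<ge> \<epsilon> * max (ppr \<alpha> E s t) \<delta> \<or>
        \<bar>r - ppr \<alpha> (E' i) s t\<bar> \<ge> \<epsilon> * max (ppr \<alpha> (E' i) s t) \<delta>"
      using zero \<delta>(1) max by auto
  qed
  then show ?thesis by (simp add: card_cartesian_product)
qed

subsection \<open>The hard graph\<close>

text \<open>The circulant relation: \<open>p\<close> is related to \<open>p\<close>, ...,
  \<open>p + d - 1\<close> modulo \<open>n\<close>. For \<open>d \<le> n\<close> it is regular of
  degree \<open>d\<close> in both directions.\<close>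

definition circ :: "nat \<Rightarrow> nat \<Rightarrow> nat rel" where
  "circ n d = {(p, p'). p < n \<and> p' < n \<and> (if p \<le> p' then p' - p else p' + n - p) < d}"

text \<open>An injective self-map of a finite set is a permutation; in the applications it is the
  cyclic distance to or from a fixed index.\<close>

lemma card_preimage_lessThan:
  fixes f :: "nat \<Rightarrow> nat"
  assumes "inj_on f {..<n}" "f ` {..<n} \<subseteq> {..<n}" "d \<le> n"
  shows "card {i. i < n \<and> f i < d} = d"
proof -
  have surj: "f ` {..<n} = {..<n}"
    using assms by (intro endo_inj_surj) auto
  have "f ` {i. i < n \<and> f i < d} = {..<d}"
  proof (intro equalityI subsetI)
    fix j assume "j \<in> {..<d}"
    moreover from this have "j \<in> f ` {..<n}" using surj assms(3) by auto
    ultimately show "j \<in> f ` {i. i < n \<and> f i < d}" by auto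
  qed auto
  moreover have "inj_on f {i. i < n \<and> f i < d}"
    using assms(1) by (rule inj_on_subset) auto
  ultimately show ?thesis
    by (metis card_image card_lessThan)
qed

lemma card_circ_out:
  assumes "p < n" "d \<le> n"
  shows "card {p'. (p, p') \<in> circ n d} = d"
proof -
  define f where "f p' = (if p \<le> p' then p' - p else p' + n - p)" for p'
  have "card {p'. p' < n \<and> f p' < d} = d"
    using assms by (intro card_preimage_lessThan inj_onI) (auto simp: f_def split: if_splits)
  then show ?thesis
    using assms(1) by (simp add: circ_def f_def)
qed

lemma card_circ_in:
  assumes "p' < n" "d \<le> n"
  shows "card {p. (p, p') \<in> circ n d} = d"
proof -
  define f where "f p = (if p \<le> p' then p' - p else p' + n - p)" for p
  have "card {p. p < n \<and> f p < d} = d"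
    using assms by (intro card_preimage_lessThan inj_onI) (auto simp: f_def split: if_splits)
  then show ?thesis
    using assms(1) by (simp add: circ_def f_def)
qed

lemma card_circ_out_le: "d \<le> n \<Longrightarrow> card {p'. (p, p') \<in> circ n d} \<le> d"
  by (cases "p < n") (simp add: card_circ_out, simp add: circ_def)

lemma card_circ_in_le: "d \<le> n \<Longrightarrow> card {p. (p, p') \<in> circ n d} \<le> d"
  by (cases "p' < n") (simp add: card_circ_in, simp add: circ_def)

lemma circ_refl: "p < n \<Longrightarrow> 0 < d \<Longrightarrow> (p, p) \<in> circ n d"
  by (simp add: circ_def)

lemma circ_less: "(p, p') \<in> circ n d \<Longrightarrow> p < n \<and> p' < n"
  by (simp add: circ_def)

lemma finite_circ [simp]: "finite (circ n d)"
  by (rule finite_subset[of _ "{..<n} \<times> {..<n}"]) (auto simp: circ_def)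

lemma card_circ:
  assumes "d \<le> n"
  shows "card (circ n d) = n * d"
proof -
  have "circ n d = (SIGMA p:{..<n}. {p'. (p, p') \<in> circ n d})"
    by (auto dest: circ_less)
  also have "card \<dots> = (\<Sum>p<n. card {p'. (p, p') \<in> circ n d})"
    by (intro card_SigmaI) (auto intro: finite_subset[of _ "{..<n}"] dest: circ_less)
  finally show ?thesis using assms by (simp add: card_circ_out)
qed

text \<open>By injectivity of \<open>f\<close>, the fibre over \<open>f p\<close> comes from the
  section of \<open>C\<close> at \<open>p\<close> alone.\<close>

lemma card_fibre_fst_le:
  assumes "inj f" "finite C" "\<And>p. card {p'. (p, p') \<in> C} \<le> b"
  shows "card {e \<in> map_prod f h ` C. fst e = u} \<le> b"
proof (cases "u \<in> range f")
  case True
  then obtain p where p: "u = f p" by blast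
  have fin: "finite {p'. (p, p') \<in> C}"
    by (rule finite_subset[of _ "snd ` C"]) (use assms(2) in force)+
  have "{e \<in> map_prod f h ` C. fst e = u} \<subseteq> (\<lambda>p'. (f p, h p')) ` {p'. (p, p') \<in> C}"
    using assms(1) by (auto simp: p inj_eq)
  then have "card {e \<in> map_prod f h ` C. fst e = u} \<le> card {p'. (p, p') \<in> C}"
    using fin by (rule surj_card_le[rotated])
  then show ?thesis using assms(3) by (rule order_trans)
next
  case False
  then have "{e \<in> map_prod f h ` C. fst e = u} = {}" by auto
  then show ?thesis by (simp only: card.empty)
qed

lemma card_fibre_snd_le:
  assumes "inj h" "finite C" "\<And>p'. card {p. (p, p') \<in> C} \<le> b"
  shows "card {e \<in> map_prod f h ` C. snd e = u} \<le> b"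
proof -
  have "card {e \<in> map_prod h f ` (C\<inverse>). fst e = u} \<le> b"
    using assms by (intro card_fibre_fst_le) auto
  moreover have "{e \<in> map_prod h f ` (C\<inverse>). fst e = u} = prod.swap ` {e \<in> map_prod f h ` C. snd e = u}"
    by force
  ultimately show ?thesis
    by (simp add: card_image)
qed

text \<open>The six kinds of nodes are the residue classes modulo 6, so the node set can be an
  initial segment of the naturals.\<close>

definition node :: "nat \<Rightarrow> nat \<Rightarrow> nat" where
  "node k p = 6 * p + k"

lemma node_eq_iff [simp]: "k < 6 \<Longrightarrow> k' < 6 \<Longrightarrow> node k p = node k' p' \<longleftrightarrow> k = k' \<and> p = p'"
  unfolding node_def by presburger

lemma inj_node: "inj (node k)"
  by (simp add: inj_def node_def)

lemma node_less_iff [simp]: "k < 6 \<Longrightarrow> node k p < 6 * n \<longleftrightarrow> p < n"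
  unfolding node_def by presburger

lemma node_cases:
  assumes "u < 6 * n"
  obtains k p where "u = node k p" "k < 6" "p < n"
  using assms by (intro that[of "u mod 6" "u div 6"]) (auto simp: node_def)

\<comment> \<open>otherwise \<open>node 1\<close> is rewritten to \<open>node (Suc 0)\<close> and no longer matches\<close>
declare One_nat_def [simp del]

section \<open>The graph, its size and its swappable edges\<close>

locale hard_graph =
  fixes n a b d D g :: nat
  assumes a: "a \<le> n" and b: "0 < b" "b \<le> n" and d: "0 < d" "d \<le> n" and D: "0 < D" "D \<le> n"
    and g: "0 < g" "g \<le> n"
begin

definition nodes :: "nat set" where
  "nodes = {..<6 * n}"

text \<open>
  The kinds 0, 1, 2, 3, 4, 5 are the sources and the nodes \<open>w\<close>, \<open>x\<close>, \<open>y\<close>, \<open>z\<close> and the targets. The first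
  source serves as a hub for all sources, and the first target of each group as a hub for its group.
  The edges inside kind 2 only serve to bring the number of edges up to \<open>\<Theta>(m)\<close>.
\<close>

definition edges :: "nat rel" where
  "edges =
     {(node 0 p, node 0 0) |p. p < n} \<union> {(node 0 0, node 1 p) |p. p < a} \<union>
     {(node 1 p, node 2 p') |p p'. (p, p') \<in> circ n b} \<union>
     {(node 2 p, node 2 p') |p p'. (p, p') \<in> circ n d} \<union>
     {(node 3 p, node 4 p') |p p'. (p, p') \<in> circ n D} \<union>
     {(node 4 p, node 5 (p div g * g)) |p. p < n} \<union>
     {(node 5 (p div g * g), node 5 p) |p. p < n} \<union> {(node 5 p, node 5 p) |p. p < n}"

lemma n: "0 < n" using g by simp

lemma div_mult_less: "p < n \<Longrightarrow> p div g * g < n"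
  by (meson div_times_less_eq_dividend le_less_trans)

lemma edges_subset: "edges \<subseteq> nodes \<times> nodes"
  using n a by (auto simp: edges_def nodes_def div_mult_less dest: circ_less)

lemma finite_edges: "finite edges"
  by (rule finite_subset[OF edges_subset]) (simp add: nodes_def)

lemma digraph_edges: "digraph nodes edges"
  unfolding digraph_def
proof (intro conjI ballI)
  show "finite nodes" "nodes \<noteq> {}" using n by (auto simp: nodes_def lessThan_empty_iff)
  show "edges \<subseteq> nodes \<times> nodes" by (rule edges_subset)
  fix u assume "u \<in> nodes"
  then obtain k p where u: "u = node k p" "k < 6" "p < n"
    by (auto simp: nodes_def elim: node_cases)
  from u(2) have "k = 0 \<or> k = 1 \<or> k = 2 \<or> k = 3 \<or> k = 4 \<or> k = 5" by auto
  moreover note circ_refl[OF u(3) b(1)] circ_refl[OF u(3) d(1)] circ_refl[OF u(3) D(1)]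
  ultimately have "\<exists>v. (node k p, v) \<in> edges"
    using u(3) unfolding edges_def by (elim disjE) fast+
  then show "edges `` {u} \<noteq> {}" using u by auto
qed

lemma card_edges_ge: "n * d \<le> card edges"
proof -
  have "n * d = card (map_prod (node 2) (node 2) ` circ n d)"
    using d inj_node by (subst card_image) (auto simp: card_circ intro: inj_on_subset[OF prod.inj_map])
  also have "\<dots> \<le> card edges"
    by (intro card_mono finite_edges) (auto simp: edges_def)
  finally show ?thesis .
qed

lemma card_edges_le: "card edges \<le> 5 * n + n * b + n * d + n * D"
proof -
  have circ: "card {(node k p, node k' p') |p p'. (p, p') \<in> circ n c} \<le> n * c" if "c \<le> n" for k k' c
  proof -
    have "{(node k p, node k' p') |p p'. (p, p') \<in> circ n c} = map_prod (node k) (node k') ` circ n c"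
      by auto
    then show ?thesis using card_image_le[OF finite_circ] card_circ[OF that] by metis
  qed
  have line: "card {(f p, h p) |p. p < c} \<le> c" for f h :: "nat \<Rightarrow> nat" and c
  proof -
    have "{(f p, h p) |p. p < c} = (\<lambda>p. (f p, h p)) ` {..<c}" by auto
    then show ?thesis using card_image_le[of "{..<c}"] by simp
  qed
  have "card edges \<le> n + a + n * b + n * d + n * D + n + n + n"
    unfolding edges_def
    by (intro order_trans[OF card_Un_le] add_mono line circ b d D)
  then show ?thesis using a by simp
qed

text \<open>The kinds 0, 1, 2 are closed: no edge leads from them to the kinds 3, 4, 5.\<close>

lemma ppr_edges: "ppr \<alpha> edges (node 0 p) (node 5 p') = 0" if "p < n"
proof (rule ppr_eq_0_if_closed[OF digraph_edges])
  show "{node k p |k p. k < 3 \<and> p < n} \<subseteq> nodes"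
    by (auto simp: nodes_def)
  show "edges `` {node k p |k p. k < 3 \<and> p < n} \<subseteq> {node k p |k p. k < 3 \<and> p < n}"
    using n a by (fastforce simp: edges_def dest: circ_less)
  show "node 0 p \<in> {node k p |k p. k < 3 \<and> p < n}"
    using that by force
  show "node 5 p' \<notin> {node k p |k p. k < 3 \<and> p < n}"
    by auto
qed

text \<open>Restricted to \<open>p < a\<close>, since only these nodes of kind 1 are reached from
  the hub of the sources.\<close>

definition source_side :: "nat rel" where
  "source_side = map_prod (node 1) (node 2) ` {(p, p') \<in> circ n b. p < a}"

text \<open>The edges into the entry nodes of the target group with number \<open>j\<close>.\<close>

definition target_side :: "nat \<Rightarrow> nat rel" where
  "target_side j = map_prod (node 3) (node 4) ` {(p, p') \<in> circ n D. p' div g = j}"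

lemma sides_subset: "source_side \<subseteq> edges" "target_side j \<subseteq> edges"
  by (auto simp: source_side_def target_side_def edges_def)

lemma card_source_side: "card source_side = a * b"
proof -
  have "{(p, p') \<in> circ n b. p < a} = (SIGMA p:{..<a}. {p'. (p, p') \<in> circ n b})"
    by auto
  also have "card \<dots> = (\<Sum>p<a. card {p'. (p, p') \<in> circ n b})"
    by (intro card_SigmaI) (auto intro: finite_subset[of _ "{..<n}"] dest: circ_less)
  also have "\<dots> = a * b"
    using a b by (simp add: card_circ_out)
  finally show ?thesis
    unfolding source_side_def using inj_node
    by (subst card_image) (auto intro: inj_on_subset[OF prod.inj_map])
qed

text \<open>Groups are blocks of \<open>g\<close> consecutive indices; \<open>j < n div g\<close>
  excludes an incomplete last block.\<close>

lemma card_target_side: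
  assumes "j < n div g"
  shows "card (target_side j) = g * D"
proof -
  have "(j + 1) * g \<le> n div g * g" using assms by (intro mult_right_mono) auto
  then have jg: "j * g + g \<le> n"
    using div_times_less_eq_dividend[of n g] by (simp only: add_mult_distrib mult_1)
  have div: "p' div g = j \<longleftrightarrow> j * g \<le> p' \<and> p' < j * g + g" for p'
    using g div_mult_mod_eq[of p' g] mod_less_divisor[of g p'] div_nat_eqI[of g j p']
    by (auto simp: mult.commute[of g] add.commute[of _ g] dividend_less_div_times)
  have "{(p, p') \<in> circ n D. p' div g = j} = (SIGMA p':{j*g..<j*g+g}. {p. (p, p') \<in> circ n D})\<inverse>"
    by (auto simp: div)
  also have "card \<dots> = (\<Sum>p'\<in>{j*g..<j*g+g}. card {p. (p, p') \<in> circ n D})"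
    unfolding card_inverse by (intro card_SigmaI) (auto intro: finite_subset[of _ "{..<n}"] dest: circ_less)
  also have "\<dots> = (\<Sum>p'\<in>{j*g..<j*g+g}. D)"
    using jg D by (intro sum.cong refl card_circ_in) auto
  finally show ?thesis
    unfolding target_side_def using inj_node
    by (subst card_image) (auto intro: inj_on_subset[OF prod.inj_map])
qed

lemma source_side_fibres:
  "card {e \<in> source_side. fst e = u} \<le> b" "card {e \<in> source_side. snd e = u} \<le> b"
proof -
  let ?C = "{(p, p') \<in> circ n b. p < a}"
  have fin: "finite ?C" "finite {p'. (p, p') \<in> circ n b}" "finite {p. (p, p') \<in> circ n b}" for p p'
    by (auto intro: finite_subset[OF _ finite_circ[of n b]] finite_subset[of _ "{..<n}"] dest: circ_less)
  have "card {p'. (p, p') \<in> ?C} \<le> b" for p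
    by (rule order_trans[OF card_mono[OF fin(2)] card_circ_out_le]) (use b in auto)
  then show "card {e \<in> source_side. fst e = u} \<le> b"
    unfolding source_side_def by (intro card_fibre_fst_le inj_node fin)
  have "card {p. (p, p') \<in> ?C} \<le> b" for p'
    by (rule order_trans[OF card_mono[OF fin(3)] card_circ_in_le]) (use b in auto)
  then show "card {e \<in> source_side. snd e = u} \<le> b"
    unfolding source_side_def by (intro card_fibre_snd_le inj_node fin)
qed

lemma target_side_fibres:
  "card {e \<in> target_side j. fst e = u} \<le> D" "card {e \<in> target_side j. snd e = u} \<le> D"
proof -
  let ?C = "{(p, p') \<in> circ n D. p' div g = j}"
  have fin: "finite ?C" "finite {p'. (p, p') \<in> circ n D}" "finite {p. (p, p') \<in> circ n D}" for p p'
    by (auto intro: finite_subset[OF _ finite_circ[of n D]] finite_subset[of _ "{..<n}"] dest: circ_less)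
  have "card {p'. (p, p') \<in> ?C} \<le> D" for p
    by (rule order_trans[OF card_mono[OF fin(2)] card_circ_out_le]) (use D in auto)
  then show "card {e \<in> target_side j. fst e = u} \<le> D"
    unfolding target_side_def by (intro card_fibre_fst_le inj_node fin)
  have "card {p. (p, p') \<in> ?C} \<le> D" for p'
    by (rule order_trans[OF card_mono[OF fin(3)] card_circ_in_le]) (use D in auto)
  then show "card {e \<in> target_side j. snd e = u} \<le> D"
    unfolding target_side_def by (intro card_fibre_snd_le inj_node fin)
qed

section \<open>Effect of a swap and the cost of noticing it\<close>

lemma out_nodes:
  "p \<noteq> 0 \<Longrightarrow> p < n \<Longrightarrow> edges `` {node 0 p} = {node 0 0}"
  "edges `` {node 0 0} = insert (node 0 0) (node 1 ` {..<a})"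
  "edges `` {node 1 p} = node 2 ` {p'. (p, p') \<in> circ n b}"
  "edges `` {node 3 p} = node 4 ` {p'. (p, p') \<in> circ n D}"
  "p < n \<Longrightarrow> edges `` {node 4 p} = {node 5 (p div g * g)}"
  "edges `` {node 5 p} \<subseteq> node 5 ` {p..<p + g}"
proof -
  \<comment> \<open>A hub points only into the block of \<open>g\<close> indices that it starts; any
    other target has only its self-loop.\<close>
  have "p' \<in> {p' div g * g..<p' div g * g + g}" for p'
    using g by (simp add: dividend_less_div_times add.commute)
  then show "edges `` {node 5 p} \<subseteq> node 5 ` {p..<p + g}"
    using g by (auto simp: edges_def)
qed (use n in \<open>auto simp: edges_def\<close>)

lemma card_out:
  "p < n \<Longrightarrow> card (edges `` {node 1 p}) = b"
  "p < n \<Longrightarrow> card (edges `` {node 3 p}) = D"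
  using b D by (auto simp: out_nodes card_image inj_on_subset[OF inj_node] card_circ_out)

text \<open>On the path source, hub, \<open>w\<close>, \<open>z\<close>, hub of the group, target,
  the out-degrees are at most 1, \<open>1 + a\<close>, \<open>b\<close>, 1, \<open>g\<close>. The
  source must differ from the hub, hence \<open>0 < p\<close>.\<close>

lemma ppr_swapped_ge:
  assumes \<alpha>: "0 < \<alpha>" "\<alpha> < 1" and p: "0 < p" "p < n" and p': "p' < n"
    and w: "(w, x) \<in> source_side" and z: "(y, z) \<in> target_side (p' div g)"
  shows "\<alpha> * (1 - \<alpha>) ^ 5 / ((1 + a) * b * g) \<le>
    ppr \<alpha> (edges - {(w, x), (y, z)} \<union> {(w, z), (y, x)}) (node 0 p) (node 5 p')"
proof -
  define E where "E = edges - {(w, x), (y, z)} \<union> {(w, z), (y, x)}"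
  obtain i i' where i: "w = node 1 i" "x = node 2 i'" "(i, i') \<in> circ n b" "i < a"
    using w by (auto simp: source_side_def)
  obtain k k' where k: "y = node 3 k" "z = node 4 k'" "(k, k') \<in> circ n D" "k' div g = p' div g"
    using z by (auto simp: target_side_def)
  have "i < n" "k' < n" using i k circ_less by blast+
  have same: "E `` {u} = edges `` {u}" if "u \<noteq> w" "u \<noteq> y" for u
    using that by (auto simp: E_def)
  have fin: "finite (E `` {u})" for u
    using finite_edges by (intro finite_Image) (auto simp: E_def)
  define r where "r = p' div g * g"
  have w_out: "E `` {w} = insert z (edges `` {w} - {x})" "x \<in> edges `` {w}"
    using w sides_subset(1) by (auto simp: E_def i k)
  have "card (E `` {w}) \<le> Suc (card (edges `` {w} - {x}))"
    unfolding w_out(1) by (rule card_insert_le_m1) (use b in auto)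
  also have "\<dots> = b"
    using w_out(2) card_out(1)[OF \<open>i < n\<close>] b finite_edges by (simp add: i(1) finite_Image)
  finally have cw: "card (E `` {w}) \<le> b" .
  have "card (insert (node 0 0) (node 1 ` {..<a})) \<le> 1 + a"
    using card_image_le[of "{..<a}" "node 1"] by (simp add: card_insert_if)
  then have c0: "card (E `` {node 0 0}) \<le> 1 + a"
    by (subst same) (auto simp: i k out_nodes)
  have cp: "card (E `` {node 0 p}) \<le> 1"
    using p by (subst same) (auto simp: i k out_nodes)
  have cz: "card (E `` {z}) \<le> 1"
    using \<open>k' < n\<close> by (subst same) (auto simp: i k out_nodes)
  have "card (edges `` {node 5 r}) \<le> card (node 5 ` {r..<r + g})"
    by (intro card_mono out_nodes) auto
  also have "\<dots> \<le> g" using card_image_le[of "{r..<r+g}" "node 5"] by simp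
  finally have cr: "card (E `` {node 5 r}) \<le> g"
    by (subst same) (auto simp: i k)
  have e: "(node 0 p, node 0 0) \<in> E" "(node 0 0, w) \<in> E" "(w, z) \<in> E" "(z, node 5 r) \<in> E"
      "(node 5 r, node 5 p') \<in> E"
    using p p' i k \<open>k' < n\<close> by (auto simp: E_def edges_def r_def)
  note step = pmf_walk_Suc_ge_edge[OF _ fin _ less_imp_le[OF \<alpha>(1)] less_imp_le[OF \<alpha>(2)], where t = "node 5 p'"]
  have "(1 - \<alpha>) / real 1 * ((1 - \<alpha>) / real (1 + a) * ((1 - \<alpha>) / real b * ((1 - \<alpha>) / real 1 * ((1 - \<alpha>) / real g * \<alpha>))))
      \<le> pmf (walk \<alpha> E (Suc (Suc (Suc (Suc (Suc (Suc 0)))))) (node 0 p)) (Some (node 5 p'))"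
    by (intro step[OF e(1) cp] step[OF e(2) c0] step[OF e(3) cw] step[OF e(4) cz] step[OF e(5) cr]
        pmf_walk_Suc_self_ge mult_nonneg_nonneg divide_nonneg_nonneg) (use \<alpha> in auto)
  also have "\<dots> \<le> ppr \<alpha> E (node 0 p) (node 5 p')"
    by (rule walk_le_ppr)
  finally show ?thesis
    by (simp add: E_def power_numeral_reduce mult_ac distrib_left)
qed

text \<open>There are \<open>a * b * (g * D)\<close> swaps, and the conditions on \<open>q\<close>
  say that each kind of query notices at most a fraction of order \<open>1 / q\<close> of them. The
  bound on \<open>p'\<close> puts the target into a complete group.\<close>

lemma expected_time_ge:
  assumes \<alpha>: "0 < \<alpha>" "\<alpha> < 1" and \<epsilon>: "0 < \<epsilon>" "\<epsilon> < 1" and pf: "p\<^sub>f < 1 / 2"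
    and \<delta>: "0 < \<delta>" "\<delta> \<le> 1" "\<delta> / (1 - \<epsilon>) \<le> \<alpha> * (1 - \<alpha>) ^ 5 / ((1 + a) * b * g)"
    and L: "adj_lists_of nodes edges L" and A: "solves_single_pair X \<alpha> \<epsilon> p\<^sub>f A"
    and p: "0 < p" "p < n" and p': "p' < n div g * g"
    and X: "X = With_In_Sorted \<Longrightarrow> b = D"
    and q: "q \<le> 2 * (a * b)" "q \<le> 2 * (g * D)" "X = With_Adj \<Longrightarrow> q \<le> 2 * (a * g)"
  shows "ennreal ((1 - 2 * p\<^sub>f) / 16 * q) \<le> expected_time (respond X nodes edges L) (A (node 0 p) (node 5 p') \<delta>)"
proof (cases "expected_time (respond X nodes edges L) (A (node 0 p) (node 5 p') \<delta>)")
  case (real T)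
  define M where "M = a * b + g * D + (if X = With_Adj then 2 * (b * D) else 0)"
  have p'n: "p' < n" using p' by (meson div_times_less_eq_dividend less_le_trans)
  have j: "p' div g < n div g"
    using p' by (simp add: less_mult_imp_div_less)
  have "ennreal ((1 - 2 * p\<^sub>f) / 2 * (card source_side * card (target_side (p' div g)))) \<le>
    of_nat (card source_side + card (target_side (p' div g)) + (if X = With_Adj then 2 * (b * D) else 0)) *
    expected_time (respond X nodes edges L) (A (node 0 p) (node 5 p') \<delta>)"
  proof (rule expected_time_ge_of_swaps[OF digraph_edges L sides_subset _ source_side_fibres
        target_side_fibres A _ _ ppr_edges \<delta>(1,2) \<epsilon> pf])
    show "node 0 p \<in> nodes" "node 5 p' \<in> nodes" "p < n"
      using p p'n by (auto simp: nodes_def)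
    fix w x y z assume w: "(w, x) \<in> source_side" and z: "(y, z) \<in> target_side (p' div g)"
    from w z obtain i i' k k' where wz: "w = node 1 i" "x = node 2 i'" "y = node 3 k" "z = node 4 k'"
        "i < n" "k < n"
      by (auto simp: source_side_def target_side_def dest!: circ_less)
    have "(w, z) \<notin> edges" "(y, x) \<notin> edges"
      by (auto simp: wz edges_def)
    moreover have "card (edges `` {w}) = card (edges `` {y})" if "X = With_In_Sorted"
      unfolding wz(1,3) card_out(1)[OF wz(5)] card_out(2)[OF wz(6)] by (rule X[OF that])
    ultimately show "(w, z) \<notin> edges \<and> (y, x) \<notin> edges \<and>
        (X = With_In_Sorted \<longrightarrow> card (edges `` {w}) = card (edges `` {y})) \<and>
        \<delta> / (1 - \<epsilon>) \<le> ppr \<alpha> (edges - {(w, x), (y, z)} \<union> {(w, z), (y, x)}) (node 0 p) (node 5 p')"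
      using order_trans[OF \<delta>(3) ppr_swapped_ge[OF \<alpha> p p'n w z]] by blast
  qed
  then have "ennreal ((1 - 2 * p\<^sub>f) / 2 * (a * b * (g * D))) \<le> of_nat M * ennreal T"
    unfolding card_source_side card_target_side[OF j] real M_def .
  then have le: "(1 - 2 * p\<^sub>f) / 2 * (a * b * (g * D)) \<le> M * T"
    using real by (simp add: ennreal_of_nat_eq_real_of_nat flip: ennreal_mult)
  have "q * (a * b) \<le> 2 * (a * b * (g * D))" "q * (g * D) \<le> 2 * (a * b * (g * D))"
    using mult_right_mono[OF q(2), of "a * b"] mult_right_mono[OF q(1), of "g * D"]
    by (simp_all add: mult_ac)
  moreover have "q * (if X = With_Adj then 2 * (b * D) else 0) \<le> 4 * (a * b * (g * D))"
  proof (cases "X = With_Adj")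
    case True
    have "q * (2 * (b * D)) \<le> 2 * (a * g) * (2 * (b * D))"
      by (rule mult_right_mono[OF q(3)[OF True]]) simp
    also have "\<dots> = 4 * (a * b * (g * D))" by simp
    finally show ?thesis unfolding if_P[OF True] .
  qed simp
  \<comment> \<open>The summands of \<open>M\<close> contribute 2, 2 and 4; together with the factor
    1/2 above this gives the 16.\<close>
  ultimately have "q * M \<le> 8 * (a * b * (g * D))"
    unfolding M_def add_mult_distrib2 by linarith
  then have "real (q * M) \<le> real (8 * (a * b * (g * D)))"
    by (rule of_nat_mono)
  then have "(1 - 2 * p\<^sub>f) / 16 * (real q * real M) \<le> (1 - 2 * p\<^sub>f) / 16 * (8 * real (a * b * (g * D)))"
    using pf by (intro mult_left_mono) auto
  also have "\<dots> = (1 - 2 * p\<^sub>f) / 2 * (a * b * (g * D))" by (simp add: field_simps)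
  also note le
  finally have "M * ((1 - 2 * p\<^sub>f) / 16 * q) \<le> M * T"
    by (simp add: mult_ac)
  moreover have "0 < M" using g D by (simp add: M_def)
  ultimately have "(1 - 2 * p\<^sub>f) / 16 * q \<le> T"
    by (simp only: mult_le_cancel_left_pos of_nat_0_less_iff)
  then show ?thesis using real by (simp add: ennreal_leI)
qed simp

end

subsection \<open>Choice of the parameters\<close>

lemma average_time_ge:
  fixes r :: real
  assumes V: "finite V" and sub: "S \<subseteq> V" "T \<subseteq> V" and r: "0 \<le> r"
    and time: "\<And>s t. s \<in> S \<Longrightarrow> t \<in> T \<Longrightarrow> ennreal r \<le> expected_time (respond X V E L) (A s t \<delta>)"
  shows "ennreal (card S * card T * r / (card V * card V)) \<le> average_time X V E L \<delta> A"
proof (cases "V = {}")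
  case False
  then have pos: "0 < card V * card V" using V by (simp add: card_gt_0_iff)
  have "ennreal (card S * card T * r) = (\<Sum>s\<in>S. \<Sum>t\<in>T. ennreal r)"
    using r by (simp add: ennreal_of_nat_eq_real_of_nat mult.assoc flip: ennreal_mult)
  also have "\<dots> \<le> (\<Sum>s\<in>S. \<Sum>t\<in>T. expected_time (respond X V E L) (A s t \<delta>))"
    by (intro sum_mono time)
  also have "\<dots> \<le> (\<Sum>s\<in>S. \<Sum>t\<in>V. expected_time (respond X V E L) (A s t \<delta>))"
    by (intro sum_mono sum_mono2 V sub) auto
  also have "\<dots> \<le> (\<Sum>s\<in>V. \<Sum>t\<in>V. expected_time (respond X V E L) (A s t \<delta>))"
    by (intro sum_mono2 V sub) auto
  finally have "ennreal (card S * card T * r) / of_nat (card V * card V) \<le> average_time X V E L \<delta> A"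
    unfolding average_time_def by (rule divide_right_mono_ennreal)
  moreover have "ennreal (card S * card T * r) / of_nat (card V * card V) =
      ennreal (card S * card T * r / (card V * card V))"
    using pos r by (simp add: ennreal_of_nat_eq_real_of_nat divide_ennreal del: of_nat_mult)
  ultimately show ?thesis by simp
qed simp

text \<open>The lost remainder is below \<open>l\<close>, which is at most the rounded
  value.\<close>

lemma le_twice_div_mult:
  fixes k l :: nat
  assumes "0 < l" "l \<le> k"
  shows "k \<le> 2 * (k div l * l)"
proof -
  have "0 < k div l" using assms by (simp add: div_greater_zero_iff)
  then have "l \<le> k div l * l" by simp
  moreover have "k mod l < l" using assms by simp
  ultimately show ?thesis using div_mult_mod_eq[of k l] by linarith
qed

text \<open>Bounding \<open>b\<close> and \<open>D\<close> by \<open>m div n\<close> keeps the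
  number of edges of order \<open>m\<close>; the upper bounds on the products keep the value after a
  swap large, and the lower bounds make swaps hard to notice. The two cases for \<open>g\<close>
  lead to the terms \<open>1 / \<delta>\<close> and the square root.\<close>

lemma hard_graph_parameters:
  fixes n m q :: nat
  assumes n: "0 < n" "n \<le> m" "m \<le> n ^ 2" and q: "q = 1 \<or> 1 \<le> q \<and> 2 * q \<le> m"
  obtains a b D g where "hard_graph n a b (m div n) D g"
    "b \<le> m div n" "D \<le> m div n" "a * b \<le> q" "g * D \<le> q" "g = 1 \<or> D = m div n"
    "X = With_In_Sorted \<longrightarrow> b = D" "q \<le> 2 * (a * b)" "q \<le> 2 * (g * D)"
    "X = With_Adj \<longrightarrow> q \<le> 2 * (a * g)"
proof -
  define d where "d = m div n"
  have d: "0 < d" "d \<le> n" "m < n * (d + 1)"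
    using n dividend_less_times_div[of n m] div_le_mono[OF n(3), of n]
    by (auto simp: d_def div_greater_zero_iff power2_eq_square add_mult_distrib2)
  \<comment> \<open>\<open>D\<close> is as large as the edge budget allows, which makes the groups
    small.\<close>
  define D where "D = min d q"
  define g where "g = q div D"
  have D: "0 < D" "D \<le> q" "D \<le> d"
    using d q by (auto simp: D_def)
  have gD: "g * D \<le> q" "q \<le> 2 * (g * D)" "0 < g"
    using le_twice_div_mult[of D q] D by (auto simp: g_def div_greater_zero_iff)
  have g1: "g = 1 \<or> D = d" using D by (auto simp: g_def D_def min_def)
  \<comment> \<open>For \<open>q = 1\<close> the bound \<open>2 * q \<le> m\<close> may fail, but
    then \<open>g = 1\<close>.\<close>
  have "g \<le> n"
  proof (cases "D = d \<and> q \<noteq> 1")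
    case True
    have "2 * (g * d) \<le> 2 * q" using gD True by simp
    also have "\<dots> \<le> m" using q True by auto
    also note d(3)
    also have "n * (d + 1) \<le> n * (2 * d)" using d(1) by (intro mult_left_mono) auto
    finally have "d * g < d * n" by (simp add: mult_ac)
    then show ?thesis by simp
  next
    case False
    then have "g = 1" using g1 D by (cases "D = 1") (auto simp: g_def)
    then show ?thesis using n by simp
  qed
  \<comment> \<open>For \<open>ADJ\<close>, many nodes \<open>w\<close> give many candidate pairs;
    otherwise the source side copies \<open>g\<close> and \<open>D\<close>, so that the out-degrees
    match.\<close>
  define a where "a = (if X = With_Adj then min q n else g)"
  define b where "b = (if X = With_Adj then q div a else D)"
  have a: "a \<le> n" "0 < a"
    using \<open>g \<le> n\<close> gD q n by (auto simp: a_def)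
  have aq: "X = With_Adj \<Longrightarrow> a \<le> q" by (simp add: a_def)
  have b: "0 < b" "a * b \<le> q" "q \<le> 2 * (a * b)"
    using aq a le_twice_div_mult[of a q] D gD by (auto simp: b_def div_greater_zero_iff a_def mult.commute)
  have bd: "b \<le> d"
  proof (cases "X = With_Adj \<and> n < q")
    case True
    then have "b = q div n" by (simp add: a_def b_def)
    also have "\<dots> \<le> d" unfolding d_def using q True n by (intro div_le_mono) auto
    finally show ?thesis .
  next
    case False
    then show ?thesis using D d(1) a by (cases "X = With_Adj") (auto simp: a_def b_def)
  qed
  have "X = With_Adj \<longrightarrow> q \<le> 2 * (a * g)"
  proof
    assume "X = With_Adj"
    \<comment> \<open>Uses \<open>d \<le> n\<close>, which comes from
      \<open>m \<le> n ^ 2\<close>.\<close>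
    then have "D \<le> a" using d by (auto simp: a_def D_def)
    then have "g * D \<le> a * g" by (simp add: mult.commute)
    then show "q \<le> 2 * (a * g)" using gD by linarith
  qed
  moreover have "hard_graph n a b d D g"
    using a b bd d D gD \<open>g \<le> n\<close> by unfold_locales auto
  moreover have "X = With_In_Sorted \<longrightarrow> b = D" by (simp add: b_def)
  ultimately show ?thesis
    using b bd D gD g1 that[of a b D g] unfolding d_def by blast
qed

theorem theorem3p2:
  fixes X :: extra_query and \<alpha> \<epsilon> p\<^sub>f :: real
  assumes "0 < \<alpha>" "\<alpha> < 1" and "0 < \<epsilon>" "\<epsilon> < 1" and "0 < p\<^sub>f" "p\<^sub>f < 1 / 2"
  shows "\<exists>c\<^sub>1 c\<^sub>2 c :: real. 0 < c\<^sub>1 \<and> 0 < c\<^sub>2 \<and> 0 < c \<and>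
    (\<forall>(n::nat) (m::nat) (\<delta>::real). 0 < n \<and> n \<le> m \<and> m \<le> n ^ 2 \<and> 0 < \<delta> \<and> \<delta> \<le> 1 \<longrightarrow>
      (\<exists>V E. digraph V E \<and>
        c\<^sub>1 * real n \<le> real (card V) \<and> real (card V) \<le> c\<^sub>2 * real n \<and>
        c\<^sub>1 * real m \<le> real (card E) \<and> real (card E) \<le> c\<^sub>2 * real m \<and>
        (\<forall>L A. adj_lists_of V E L \<and> solves_single_pair X \<alpha> \<epsilon> p\<^sub>f A \<longrightarrow>
          average_time X V E L \<delta> A \<ge>
            ennreal (c * Min {real m, sqrt ((real m / real n) / \<delta>), 1 / \<delta>}))))"
proof -
  \<comment> \<open>Twice \<kappa> is the largest \<open>(1 + a) * b * g * \<delta>\<close> for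
    which the path bound reaches \<open>\<delta> / (1 - \<epsilon>)\<close>.\<close>
  define \<kappa> where "\<kappa> = \<alpha> * (1 - \<alpha>) ^ 5 * (1 - \<epsilon>) / 2"
  \<comment> \<open>\<open>9216 = 16 * 4 * 144\<close>: 16 from the time bound, 4 from rounding
    \<open>q\<close>, and 144 because the sources and the targets used each make up at least a
    twelfth of all nodes.\<close>
  define c where "c = (1 - 2 * p\<^sub>f) * \<kappa> / 9216"
  have "\<alpha> * (1 - \<alpha>) ^ 5 * (1 - \<epsilon>) \<le> 1 * 1 * 1"
    using assms by (intro mult_mono power_le_one) auto
  then have \<kappa>: "0 < \<kappa>" "\<kappa> < 1"
    using assms by (auto simp: \<kappa>_def)
  have c: "0 < c" "c \<le> \<kappa> / 2"
    using assms \<kappa> by (auto simp: c_def intro!: mult_pos_pos)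
  show ?thesis
  \<comment> \<open>There are \<open>6 * n\<close> nodes, at most \<open>5 * n + 3 * m\<close>
    edges, and at least \<open>n * (m div n)\<close> edges, which is at least
    \<open>m / 2\<close>.\<close>
  proof (rule exI[of _ "1 / 2"], rule exI[of _ 8], rule exI[of _ c], intro conjI allI impI)
    fix n m :: nat and \<delta> :: real
    assume "0 < n \<and> n \<le> m \<and> m \<le> n ^ 2 \<and> 0 < \<delta> \<and> \<delta> \<le> 1"
    then have nm: "0 < n" "n \<le> m" "m \<le> n ^ 2" and \<delta>: "0 < \<delta>" "\<delta> \<le> 1" by auto
    define Q where "Q = Min {real m, sqrt ((real m / real n) / \<delta>), 1 / \<delta>}"
    have Q: "Q \<le> m" "Q \<le> sqrt ((real m / real n) / \<delta>)" "Q \<le> 1 / \<delta>" "0 < Q"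
      using nm \<delta> by (auto simp: Q_def)
    \<comment> \<open>If \<open>\<kappa> * Q < 2\<close>, the claimed bound is at most 1, and
      \<open>q = 1\<close> just yields some valid graph.\<close>
    define q where "q = max 1 (nat \<lfloor>\<kappa> * Q / 2\<rfloor>)"
    have q_le: "real q \<le> \<kappa> * Q / 2" "\<kappa> * Q / 4 \<le> q" "1 \<le> q" if "1 \<le> \<kappa> * Q / 2"
    proof -
      have "q = nat \<lfloor>\<kappa> * Q / 2\<rfloor>" using that by (simp add: q_def max_def le_nat_iff le_floor_iff)
      then show "real q \<le> \<kappa> * Q / 2" "\<kappa> * Q / 4 \<le> q" "1 \<le> q"
        using that by (simp_all add: q_def of_nat_nat) linarith+
    qed
    have \<kappa>Q: "\<kappa> * Q \<le> Q" using \<kappa> Q(4) by simp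
    have "q = 1 \<or> 1 \<le> q \<and> 2 * q \<le> m"
    proof (cases "1 \<le> \<kappa> * Q / 2")
      case True
      have "real (2 * q) \<le> real m" using q_le(1)[OF True] \<kappa>Q Q(1) by simp
      then have "2 * q \<le> m" by (simp only: of_nat_le_iff)
      with q_le(3)[OF True] show ?thesis by simp
    next
      case False
      then have "\<lfloor>\<kappa> * Q / 2\<rfloor> < 1" by (simp add: floor_less_iff)
      then show ?thesis by (simp add: q_def)
    qed
    then obtain a b D g where H: "hard_graph n a b (m div n) D g"
      and bD: "b \<le> m div n" "D \<le> m div n" "a * b \<le> q" "g * D \<le> q" "g = 1 \<or> D = m div n"
      and par: "X = With_In_Sorted \<longrightarrow> b = D" "q \<le> 2 * (a * b)" "q \<le> 2 * (g * D)"
        "X = With_Adj \<longrightarrow> q \<le> 2 * (a * g)"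
      by (rule hard_graph_parameters[OF nm, where X = X]) blast
    interpret hard_graph n a b "m div n" D g by (rule H)
    have card_V: "card nodes = 6 * n" by (simp add: nodes_def)
    have "m \<le> 2 * (n * (m div n))"
      using le_twice_div_mult[OF nm(1,2)] by (simp add: mult.commute)
    then have m_half: "real m \<le> 2 * (n * real (m div n))"
      by (metis of_nat_le_iff of_nat_mult of_nat_numeral)
    have "n * b \<le> m" "n * (m div n) \<le> m" "n * D \<le> m"
      using bD(1,2) by (meson mult_le_mono2 order_trans times_div_less_eq_dividend)+
    then have "card edges \<le> 8 * m"
      using card_edges_le nm(2) by linarith
    then have E_le: "real (card edges) \<le> 8 * real m"
      by (metis of_nat_le_iff of_nat_mult of_nat_numeral)
    have E_ge: "1 / 2 * real m \<le> real (card edges)"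
      using card_edges_ge m_half of_nat_mono[of "n * (m div n)" "card edges", where 'a = real] by simp
    have "ennreal (c * Q) \<le> average_time X nodes edges L \<delta> A"
      if L: "adj_lists_of nodes edges L" and A: "solves_single_pair X \<alpha> \<epsilon> p\<^sub>f A" for L A
    proof (cases "1 \<le> \<kappa> * Q / 2")
      case False
      have "c * Q \<le> \<kappa> / 2 * Q" using c Q(4) by (intro mult_right_mono) auto
      then have "c * Q \<le> 1" using False by simp
      then have "ennreal (c * Q) \<le> ennreal (card nodes * card nodes * (1::real) / (card nodes * card nodes))"
        using nm by (intro ennreal_leI) (simp add: card_V)
      also have "\<dots> \<le> average_time X nodes edges L \<delta> A"
        by (rule average_time_ge) (auto simp: nodes_def expected_time_ge_1)
      finally show ?thesis .
    next
      case True
      note q = q_le[OF True]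
      have "2 \<le> real m" using True \<kappa> \<kappa>Q Q by linarith
      \<comment> \<open>Leaving out the hub then keeps at least half of the sources.\<close>
      then have n2: "2 \<le> n" using nm by (cases "n = 1") auto
      have a0: "1 \<le> a" using par(2) q(3) by (cases a) auto
      have q\<delta>: "q * \<delta> \<le> \<kappa> / 2"
      proof -
        have "q * \<delta> \<le> \<kappa> * Q / 2 * \<delta>" using q \<delta> by (intro mult_right_mono) auto
        also have "\<dots> \<le> \<kappa> * (1 / \<delta>) / 2 * \<delta>" using Q \<delta> \<kappa> by (intro mult_right_mono divide_right_mono mult_left_mono) auto
        finally show ?thesis using \<delta> by simp
      qed
      \<comment> \<open>For \<open>g = 1\<close> this follows from
        \<open>Q \<le> 1 / \<delta>\<close>. Otherwise \<open>g\<close> is at most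
        \<open>2 * n * q / m\<close>, so a bound on \<open>q ^ 2 * n * \<delta> / m\<close> is
        required, whence the square root in \<open>Q\<close>.\<close>
      have qg: "q * g * \<delta> \<le> \<kappa>"
        using bD(5)
      proof
        assume "g = 1"
        then show ?thesis using q\<delta> \<kappa> by simp
      next
        assume D: "D = m div n"
        have "real g * real m \<le> real g * (2 * (n * real (m div n)))"
          using m_half by (intro mult_left_mono) auto
        also have "\<dots> = 2 * n * real (g * D)" by (simp add: D)
        also have "\<dots> \<le> 2 * n * real q" using bD(4) by (intro mult_left_mono) (auto simp del: of_nat_mult)
        finally have gm: "real g * real m \<le> 2 * n * real q" .
        have "real q ^ 2 \<le> (\<kappa> / 2 * sqrt ((real m / real n) / \<delta>)) ^ 2"
          using q(1) Q(2) \<kappa> by (intro power_mono order_trans[OF q(1)]) auto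
        also have "\<dots> = \<kappa>\<^sup>2 / 4 * ((real m / real n) / \<delta>)"
          using \<delta> by (simp add: power_mult_distrib power_divide)
        finally have q2: "real q ^ 2 * (n * \<delta>) \<le> \<kappa>\<^sup>2 / 4 * m"
          using \<delta> nm by (simp add: field_simps)
        have "(q * g * \<delta>) * m = q * \<delta> * (real g * m)" by simp
        also have "\<dots> \<le> q * \<delta> * (2 * n * real q)" using gm \<delta> by (intro mult_left_mono) auto
        also have "\<dots> = 2 * (real q ^ 2 * (n * \<delta>))" by (simp add: power2_eq_square)
        also have "\<dots> \<le> \<kappa>\<^sup>2 / 2 * m" using q2 by simp
        also have "\<dots> \<le> \<kappa> * m" using \<kappa> by (intro mult_right_mono) (auto simp: power2_eq_square mult_le_one)
        finally show ?thesis using nm by simp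
      qed
      have "(1 + real a) * b * g \<le> (2 * real a) * b * g"
        using a0 by (intro mult_right_mono) auto
      also have "\<dots> = 2 * real (a * b) * g" by simp
      also have "\<dots> \<le> 2 * real q * g"
        using bD(3) by (intro mult_right_mono mult_left_mono) (auto simp del: of_nat_mult)
      finally have "(1 + real a) * b * g * \<delta> \<le> 2 * real q * g * \<delta>"
        by (rule mult_right_mono) (use \<delta> in simp)
      also have "\<dots> \<le> 2 * \<kappa>" using qg by simp
      finally have "real ((1 + a) * b * g) * \<delta> \<le> \<alpha> * (1 - \<alpha>) ^ 5 * (1 - \<epsilon>)"
        by (simp add: \<kappa>_def)
      moreover have "0 < (1 + a) * b * g" using b g by simp
      ultimately have "\<delta> / (1 - \<epsilon>) \<le> \<alpha> * (1 - \<alpha>) ^ 5 / real ((1 + a) * b * g)"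
        using assms(4)
        by (simp add: pos_divide_le_eq pos_le_divide_eq mult.commute
            del: of_nat_mult of_nat_add nat_0_less_mult_iff)
      note time = expected_time_ge[OF assms(1-4,6) \<delta> this L A _ _ _ par[rule_format]]
      define r where "r = (1 - 2 * p\<^sub>f) / 16 * q"
      \<comment> \<open>The sources without the hub, and below the targets in complete
        groups.\<close>
      define S where "S = node 0 ` {1..<n}"
      define T where "T = node 5 ` {..<n div g * g}"
      have cards: "card S = n - 1" "card T = n div g * g"
        by (simp_all add: S_def T_def card_image inj_on_subset[OF inj_node])
      have sub: "S \<subseteq> nodes" "T \<subseteq> nodes"
        by (auto simp: S_def T_def nodes_def intro: less_le_trans[OF _ div_times_less_eq_dividend[of n g]])
      have r: "0 \<le> r" using assms by (simp add: r_def)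
      have "n \<le> 2 * (n div g * g)"
        using le_twice_div_mult[OF g] .
      then have "n * n \<le> (2 * card S) * (2 * card T)"
        unfolding cards using n2 by (intro mult_mono) auto
      then have "real (n * n) \<le> real ((2 * card S) * (2 * card T))"
        by (rule of_nat_mono)
      then have "real n * n * r \<le> 4 * (card S * card T * r)"
        using mult_right_mono[OF _ r, of "real n * n" "4 * (card S * card T)"] by (simp add: mult_ac)
      then have "r / 144 \<le> card S * card T * r / (card nodes * card nodes)"
        using nm by (simp add: card_V field_simps)
      moreover have "c * Q = (1 - 2 * p\<^sub>f) / 16 * (\<kappa> * Q / 4) / 144"
        by (simp add: c_def)
      moreover have "\<dots> \<le> r / 144"
        unfolding r_def using q(2) assms by (intro divide_right_mono mult_left_mono) auto
      ultimately have "ennreal (c * Q) \<le> ennreal (card S * card T * r / (card nodes * card nodes))"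
        by (intro ennreal_leI) linarith
      also have "\<dots> \<le> average_time X nodes edges L \<delta> A"
      proof (rule average_time_ge[OF _ sub r])
        fix s t assume "s \<in> S" "t \<in> T"
        then show "ennreal r \<le> expected_time (respond X nodes edges L) (A s t \<delta>)"
          using time by (auto simp: S_def T_def r_def)
      qed (simp add: nodes_def)
      finally show ?thesis .
    qed
    then show "\<exists>V E. digraph V E \<and>
        1 / 2 * real n \<le> real (card V) \<and> real (card V) \<le> 8 * real n \<and>
        1 / 2 * real m \<le> real (card E) \<and> real (card E) \<le> 8 * real m \<and>
        (\<forall>L A. adj_lists_of V E L \<and> solves_single_pair X \<alpha> \<epsilon> p\<^sub>f A \<longrightarrow>
          average_time X V E L \<delta> A \<ge> ennreal (c * Min {real m, sqrt ((real m / real n) / \<delta>), 1 / \<delta>}))"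
      unfolding Q_def[symmetric] using digraph_edges E_le E_ge
      by (intro exI[of _ nodes] exI[of _ edges]) (auto simp: card_V)
  qed (use c in auto)
qed

end
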